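(* Let $G$ be an $(s,k)$-edge-connected graph such that $k\geq 2$ and $\deg(s)\geq 4$. Suppose $I(L(G,s,k))$ is connected. Then: (a) $I(L(G,s,k))$ is either a cycle or a path; (b) every vertex of $I(L(G,s,k))$ of degree $2$ is a maximal independent set of size $2$; (c) if $I(L(G,s,k))$ is a cycle, then the complement of $L(G,s,k)$ is a Hamilton cycle; (d) if $I(L(G,s,k))$ is a path of length at least $2$ or a cycle, then $k$ is odd; (e) if $\mathcal{D}$ is the collection of the dangerous sets corresponding to the maximal independent sets of $L(G,s,k)$, then $\bigcup\mathcal{D}=V(G)\setminus\{s\}$; (f) if $I(L(G,s,k))$ is a path of length $1$, then the complement of $L(G,s,k)$ consists of two cliques of size $(\deg(s)+1)/2$ sharing exactly one vertex (equivalently, $L(G,s,k)$ is an isolated vertex plus a balanced complete bipartite graph); (g) if $I(L(G,s,k))$ is a path $I_1,\dots,I_m$ of length at least $2$ and $A_i$ is the dangerous set corresponding to $I_i$, then $|\delta(\{s\}:A_1)|=|\delta(\{s\}:A_m)|=:l$, $l\leq (k+3)/2$, and $|\delta(A_1:A_m)|=(k+3)/2-l$; (h) if $I(L(G,s,k))$ is a path, then the complement of $L(G,s,k)$ consists of two cliques of the same size, at most $(k+3)/2$, joined by a path.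
   Context: All graphs are finite loopless multigraphs. For $X\subseteq V(G)$, $\delta(X)$ is the set of edges with exactly one end in $X$; for disjoint $X,Y$, $\delta(X:Y)$ is the set of edges with one end in $X$ and the other in $Y$. A graph $G$ is $(s,k)$-edge-connected if $G$ has at least three vertices, $s\in V(G)$, $k$ is a positive integer, and any two vertices of $G$ different from $s$ are joined by $k$ pairwise edge-disjoint paths in $G$ (which may pass through $s$). Lifting edges $sv,sw$ means deleting them and adding $vw$ if $v\ne w$, only deleting them if $v=w$; result $G_{v,w}$. $sv,sw$ are $k$-liftable if $G_{v,w}$ is $(s,k)$-edge-connected. $L(G,s,k)$ has vertex set the edges at $s$, adjacent iff $k$-liftable. A set $A\subseteq V(G)\setminus\{s\}$ is dangerous if $A\ne\emptyset$, $V(G)\setminus(A\cup\{s\})\neq\emptyset$ and $|\delta(A)|\le k+1$. For an independent set $F$ of $L(G,s,k)$ with $|F|\ge 2$ and $F\ne V(L(G,s,k))$, the dangerous set corresponding to $F$ is the unique inclusion-minimal dangerous set containing the end other than $s$ of every edge of $F$ (it exists and is unique when $s$ is not incident with a cut-edge). For a graph $H$, the independence graph $I(H)$ has as vertices the maximal independent sets of $H$, two adjacent iff they intersect. "Two cliques joined by a path" allows a path of length $0$.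
   Formalization: In (g), |δ(A_1:A_m)|=(k+3)/2−l is proved for paths of length at least 3; for length exactly 2 it is false (k=3, edges s1,s1,s2,s3,s3,s4,12,24,34) and the correct value k+1−l is proved instead. *)

theory Defs
  imports Complex_Main
begin

text \<open>Finite loopless multigraphs: edges are identifiers, and an edge has a two-element set of ends.\<close>

record ('v, 'e) mgraph =
  verts :: "'v set"
  edges :: "'e set"
  ends :: "'e \<Rightarrow> 'v set"

definition multigraph :: "('v, 'e) mgraph \<Rightarrow> bool" where
  "multigraph G \<longleftrightarrow> finite (verts G) \<and> finite (edges G) \<and>
     (\<forall>e\<in>edges G. ends G e \<subseteq> verts G \<and> card (ends G e) = 2)"

definition cut :: "('v, 'e) mgraph \<Rightarrow> 'v set \<Rightarrow> 'e set" where
  "cut G X = {e \<in> edges G. card (ends G e \<inter> X) = 1}"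

text \<open>Pitfall: if the independence graph of the lifting graph is a path \<open>I\<^sub>1, I\<^sub>2, I\<^sub>3\<close> with
  corresponding dangerous sets \<open>A\<^sub>1, A\<^sub>2, A\<^sub>3\<close>, then \<open>cut_between G A\<^sub>1 A\<^sub>3\<close> also contains the
  \<open>(k - 1) / 2\<close> edges between \<open>A\<^sub>1 \<inter> A\<^sub>2\<close> and \<open>A\<^sub>2 \<inter> A\<^sub>3\<close>. Its size is therefore
  \<open>k + 1 - l\<close>, not the value \<open>(k + 3) / 2 - l\<close> that is correct for longer paths. Example with
  \<open>k = 3\<close>, \<open>l = 3\<close>: edges \<open>s1, s1, s2, s3, s3, s4, 12, 24, 34\<close>; here \<open>A\<^sub>1 = {3, 4}\<close>,
  \<open>A\<^sub>2 = {2, 4}\<close>, \<open>A\<^sub>3 = {1, 2}\<close>, and the edge \<open>24\<close> joins \<open>A\<^sub>1\<close> to \<open>A\<^sub>3\<close>.\<close>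

definition cut_between :: "('v, 'e) mgraph \<Rightarrow> 'v set \<Rightarrow> 'v set \<Rightarrow> 'e set" where
  "cut_between G X Y = {e \<in> edges G. \<exists>x\<in>X. \<exists>y\<in>Y. ends G e = {x, y}}"

definition deg :: "('v, 'e) mgraph \<Rightarrow> 'v \<Rightarrow> nat" where
  "deg G v = card (cut G {v})"

definition mpath :: "('v, 'e) mgraph \<Rightarrow> 'v \<Rightarrow> 'v \<Rightarrow> 'v list \<Rightarrow> 'e list \<Rightarrow> bool" where
  "mpath G u w vs es \<longleftrightarrow>
     length vs = length es + 1 \<and> distinct vs \<and> set vs \<subseteq> verts G \<and> hd vs = u \<and> last vs = w \<and>
     (\<forall>i < length es. es ! i \<in> edges G \<and> ends G (es ! i) = {vs ! i, vs ! Suc i})"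

definition edge_disjoint_paths :: "('v, 'e) mgraph \<Rightarrow> nat \<Rightarrow> 'v \<Rightarrow> 'v \<Rightarrow> bool" where
  "edge_disjoint_paths G k u w \<longleftrightarrow>
     (\<exists>(vs :: nat \<Rightarrow> 'v list) (es :: nat \<Rightarrow> 'e list).
        (\<forall>i<k. mpath G u w (vs i) (es i)) \<and>
        (\<forall>i<k. \<forall>j<k. i \<noteq> j \<longrightarrow> set (es i) \<inter> set (es j) = {}))"

definition sk_edge_connected :: "('v, 'e) mgraph \<Rightarrow> 'v \<Rightarrow> nat \<Rightarrow> bool" where
  "sk_edge_connected G s k \<longleftrightarrow>
     card (verts G) \<ge> 3 \<and> s \<in> verts G \<and> k > 0 \<and>
     (\<forall>u \<in> verts G - {s}. \<forall>w \<in> verts G - {s}. u \<noteq> w \<longrightarrow> edge_disjoint_paths G k u w)"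

definition far_end :: "('v, 'e) mgraph \<Rightarrow> 'v \<Rightarrow> 'e \<Rightarrow> 'v" where
  "far_end G s e = (THE v. v \<in> ends G e \<and> v \<noteq> s)"

text \<open>If the far ends differ, the new edge takes over the identifier \<open>e\<close>, which the lift has freed.\<close>

definition lift :: "('v, 'e) mgraph \<Rightarrow> 'v \<Rightarrow> 'e \<Rightarrow> 'e \<Rightarrow> ('v, 'e) mgraph" where
  "lift G s e f =
     (if far_end G s e = far_end G s f
      then G\<lparr>edges := edges G - {e, f}\<rparr>
      else G\<lparr>edges := edges G - {f}, ends := (ends G)(e := {far_end G s e, far_end G s f})\<rparr>)"

definition liftable :: "('v, 'e) mgraph \<Rightarrow> 'v \<Rightarrow> nat \<Rightarrow> 'e \<Rightarrow> 'e \<Rightarrow> bool" where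
  "liftable G s k e f \<longleftrightarrow> sk_edge_connected (lift G s e f) s k"

text \<open>Simple graphs, whose edges (\<open>links\<close>) are two-element sets of nodes.\<close>

record 'a sgraph =
  nodes :: "'a set"
  links :: "'a set set"

definition pairs :: "'a set \<Rightarrow> 'a set set" where
  "pairs K = {{x, y} |x y. x \<in> K \<and> y \<in> K \<and> x \<noteq> y}"

definition complement :: "'a sgraph \<Rightarrow> 'a sgraph" where
  "complement H = \<lparr>nodes = nodes H, links = pairs (nodes H) - links H\<rparr>"

definition sdegree :: "'a sgraph \<Rightarrow> 'a \<Rightarrow> nat" where
  "sdegree H x = card {l \<in> links H. x \<in> l}"

definition path_links :: "'a list \<Rightarrow> 'a set set" where
  "path_links p = {{p ! i, p ! Suc i} |i. Suc i < length p}"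

definition sconnected :: "'a sgraph \<Rightarrow> bool" where
  "sconnected H \<longleftrightarrow> nodes H \<noteq> {} \<and>
     (\<forall>x\<in>nodes H. \<forall>y\<in>nodes H. \<exists>p. p \<noteq> [] \<and> distinct p \<and> set p \<subseteq> nodes H \<and>
        path_links p \<subseteq> links H \<and> hd p = x \<and> last p = y)"

text \<open>The whole graph \<open>H\<close> is the path with vertex sequence \<open>p\<close>; its length is \<open>length p - 1\<close>.\<close>

definition is_path_seq :: "'a sgraph \<Rightarrow> 'a list \<Rightarrow> bool" where
  "is_path_seq H p \<longleftrightarrow> p \<noteq> [] \<and> distinct p \<and> nodes H = set p \<and> links H = path_links p"

definition is_path_of_length :: "'a sgraph \<Rightarrow> nat \<Rightarrow> bool" where
  "is_path_of_length H n \<longleftrightarrow> (\<exists>p. is_path_seq H p \<and> length p = n + 1)"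

definition is_path :: "'a sgraph \<Rightarrow> bool" where
  "is_path H \<longleftrightarrow> (\<exists>n. is_path_of_length H n)"

text \<open>The whole graph \<open>H\<close> is a cycle. In particular the cycle passes through every node, so
  \<open>is_cycle (complement H)\<close> says that the complement of \<open>H\<close> is a Hamilton cycle on \<open>nodes H\<close>.\<close>

definition is_cycle :: "'a sgraph \<Rightarrow> bool" where
  "is_cycle H \<longleftrightarrow> (\<exists>c. length c \<ge> 3 \<and> distinct c \<and> nodes H = set c \<and>
     links H = insert {last c, hd c} (path_links c))"

definition independent :: "'a sgraph \<Rightarrow> 'a set \<Rightarrow> bool" where
  "independent H F \<longleftrightarrow> F \<subseteq> nodes H \<and> pairs F \<inter> links H = {}"

definition maximal_independent :: "'a sgraph \<Rightarrow> 'a set \<Rightarrow> bool" where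
  "maximal_independent H F \<longleftrightarrow>
     independent H F \<and> (\<forall>F'. independent H F' \<and> F \<subseteq> F' \<longrightarrow> F' = F)"

definition independence_graph :: "'a sgraph \<Rightarrow> 'a set sgraph" where
  "independence_graph H =
     \<lparr>nodes = {F. maximal_independent H F},
      links = {{F, F'} |F F'. maximal_independent H F \<and> maximal_independent H F' \<and>
                 F \<noteq> F' \<and> F \<inter> F' \<noteq> {}}\<rparr>"

definition lifting_graph :: "('v, 'e) mgraph \<Rightarrow> 'v \<Rightarrow> nat \<Rightarrow> 'e sgraph" where
  "lifting_graph G s k =
     \<lparr>nodes = cut G {s},
      links = {{e, f} |e f. e \<in> cut G {s} \<and> f \<in> cut G {s} \<and> e \<noteq> f \<and> liftable G s k e f}\<rparr>"

definition dangerous :: "('v, 'e) mgraph \<Rightarrow> 'v \<Rightarrow> nat \<Rightarrow> 'v set \<Rightarrow> bool" where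
  "dangerous G s k A \<longleftrightarrow>
     A \<subseteq> verts G - {s} \<and> A \<noteq> {} \<and> verts G - (A \<union> {s}) \<noteq> {} \<and> card (cut G A) \<le> k + 1"

definition dangerous_cover :: "('v, 'e) mgraph \<Rightarrow> 'v \<Rightarrow> nat \<Rightarrow> 'e set \<Rightarrow> 'v set \<Rightarrow> bool" where
  "dangerous_cover G s k F A \<longleftrightarrow> dangerous G s k A \<and> far_end G s ` F \<subseteq> A"

text \<open>Meaningful for independent sets \<open>F\<close> of the lifting graph with at least two elements and
  different from the set of all edges at \<open>s\<close>, where the minimal set exists and is unique.\<close>

definition dangerous_set_of :: "('v, 'e) mgraph \<Rightarrow> 'v \<Rightarrow> nat \<Rightarrow> 'e set \<Rightarrow> 'v set" where
  "dangerous_set_of G s k F =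
     (THE A. dangerous_cover G s k F A \<and> (\<forall>B. dangerous_cover G s k F B \<and> B \<subseteq> A \<longrightarrow> B = A))"

definition two_cliques_sharing_vertex :: "'a sgraph \<Rightarrow> 'a set \<Rightarrow> 'a set \<Rightarrow> bool" where
  "two_cliques_sharing_vertex H K K' \<longleftrightarrow>
     nodes H = K \<union> K' \<and> links H = pairs K \<union> pairs K' \<and> card (K \<inter> K') = 1"

definition isolated_plus_balanced_complete_bipartite :: "'a sgraph \<Rightarrow> bool" where
  "isolated_plus_balanced_complete_bipartite H \<longleftrightarrow>
     (\<exists>v X Y. v \<notin> X \<union> Y \<and> X \<inter> Y = {} \<and> finite X \<and> finite Y \<and> card X = card Y \<and>
        nodes H = insert v (X \<union> Y) \<and> links H = {{x, y} |x y. x \<in> X \<and> y \<in> Y})"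

text \<open>The path \<open>p\<close> meets each clique in exactly one of its ends. If \<open>p\<close> has a single vertex
  (length 0), the cliques share exactly that vertex; otherwise they are disjoint.\<close>

definition two_cliques_joined_by_path :: "'a sgraph \<Rightarrow> 'a set \<Rightarrow> 'a set \<Rightarrow> 'a list \<Rightarrow> bool" where
  "two_cliques_joined_by_path H K K' p \<longleftrightarrow>
     p \<noteq> [] \<and> distinct p \<and> K \<inter> set p = {hd p} \<and> K' \<inter> set p = {last p} \<and>
     K \<inter> K' = (if length p = 1 then {hd p} else {}) \<and>
     nodes H = K \<union> K' \<union> set p \<and> links H = pairs K \<union> pairs K' \<union> path_links p"

end

theory Submission
  imports Defs
begin

text \<open>
  By Menger's theorem two edges at \<open>s\<close> are not liftable iff some dangerous set contains both far ends.
  Submodularity shows that two dangerous sets sharing two edges at \<open>s\<close> are nested, and that two crossing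
  ones sharing an edge \<open>e\<close> have cut size exactly \<open>k + 1\<close>, have differences of cut size exactly \<open>k\<close>, and
  have \<open>e\<close> as the only edge from their intersection to the outside of their union. Hence every
  independent set is covered by one dangerous set, and the maximal independent sets behave like lines:
  two of them share at most one edge, no edge lies in three of them (three-set submodularity), and a
  line with two neighbours is the pair of its two intersection points, its dangerous set being the
  disjoint union of the two intersections, each of cut size \<open>k\<close>; these cut sizes are odd. So the
  independence graph has maximum degree two. For odd \<open>k\<close>, two sets of cut size \<open>k\<close> cannot cross, which
  makes dangerous sets of nonadjacent lines disjoint, and the counts follow by adding up the edges
  leaving the two end blocks.
\<close>

section \<open>Edge-disjoint paths and cuts\<close>

text \<open>Two dangerous sets are uncrossed through their differences, not through intersection and
  union: the union may be all of \<open>verts G - {s}\<close>, where the lower bound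
  \<open>k\<close> fails. The edge that they share at \<open>s\<close> absorbs the two extra units
  in \<open>d A + d B \<le> 2 * k + 2\<close>, so every estimate is an equality; this is the source
  of the exact cut sizes and of all parity statements. Connectedness does more than give a cycle or
  a path. It excludes maximal independent sets with a single edge, and the second edge of each line
  is what keeps the differences nonempty. The constant \<open>(k + 3) / 2\<close> is the degree
  count of an end block, the part of an end set outside its neighbour. Of its \<open>k\<close>
  edges, \<open>(k - 1) / 2\<close> go to the adjacent intersection and \<open>l - 1\<close> to
  \<open>s\<close>; the remaining \<open>(k + 3) / 2 - l\<close> go to the opposite end block. With
  only three lines the two intersections are the two halves of the middle set and exchange another
  \<open>(k - 1) / 2\<close> edges, hence the separate formula for that case.\<close>

inductive epath :: "('v, 'e) mgraph \<Rightarrow> ('e \<Rightarrow> 'v \<Rightarrow> bool) \<Rightarrow> 'v \<Rightarrow> 'v \<Rightarrow> 'v list \<Rightarrow> 'e list \<Rightarrow> bool"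
  for G c w where
  epath_nil: "w \<in> verts G \<Longrightarrow> epath G c w w [w] []"
| epath_cons: "e \<in> edges G \<Longrightarrow> ends G e = {x, y} \<Longrightarrow> x \<in> verts G \<Longrightarrow> c e x \<Longrightarrow>
    epath G c w y vs es \<Longrightarrow> x \<notin> set vs \<Longrightarrow> epath G c w x (x # vs) (e # es)"

lemma epath_shape:
  assumes "epath G c w x vs es"
  shows "vs \<noteq> [] \<and> hd vs = x \<and> last vs = w \<and> set es \<subseteq> edges G \<and> (\<forall>e\<in>set es. ends G e \<subseteq> set vs)"
  using assms by induction (auto simp: neq_Nil_conv)

lemma epath_mpath:
  assumes "epath G c w x vs es"
  shows "mpath G x w vs es"
  using assms
proof induction
  case epath_nil
  then show ?case by (simp add: mpath_def)
next
  case (epath_cons e x y vs es)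
  have *: "vs \<noteq> []" "hd vs = y" using epath_shape[OF epath_cons.hyps(5)] by auto
  have "ends G ((e # es) ! i) = {(x # vs) ! i, (x # vs) ! Suc i} \<and> (e # es) ! i \<in> edges G"
    if "i < length (e # es)" for i
    using that epath_cons * by (cases i) (auto simp: mpath_def hd_conv_nth)
  with epath_cons * show ?case by (auto simp: mpath_def)
qed

lemma epath_suffix:
  assumes "epath G c w y vs es" "x \<in> set vs"
  shows "\<exists>vs' es'. epath G c w x vs' es'"
  using assms
proof induction
  case epath_nil
  then show ?case by (auto intro: epath.epath_nil)
next
  case (epath_cons e z y vs es)
  show ?case
  proof (cases "x = z")
    case True
    then show ?thesis using epath.epath_cons[OF epath_cons.hyps] by blast
  next
    case False
    then show ?thesis using epath_cons by auto
  qed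
qed

text \<open>Prepending \<open>x\<close> could repeat a vertex; in that case the part of the path
  from \<open>x\<close> onwards already serves.\<close>

lemma epath_extend:
  assumes "epath G c w y vs es" "e \<in> edges G" "ends G e = {x, y}" "x \<in> verts G" "c e x"
  shows "\<exists>vs' es'. epath G c w x vs' es'"
proof (cases "x \<in> set vs")
  case True
  then show ?thesis using epath_suffix assms(1) by fast
next
  case False
  then show ?thesis using epath_cons[OF assms(2-5,1)] by blast
qed

section \<open>Unit flows\<close>

text \<open>\<open>g e v\<close> is the amount that flow along \<open>e\<close> takes out of \<open>v\<close>, so that \<open>- 1\<close> means that the edge is used towards \<open>v\<close>.\<close>

definition unit_flow :: "('v, 'e) mgraph \<Rightarrow> ('e \<Rightarrow> 'v \<Rightarrow> int) \<Rightarrow> bool" where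
  "unit_flow G g \<longleftrightarrow> (\<forall>e\<in>edges G. (\<forall>v. v \<notin> ends G e \<longrightarrow> g e v = 0) \<and>
     (\<forall>v. \<bar>g e v\<bar> \<le> 1) \<and> (\<Sum>v\<in>ends G e. g e v) = 0)"

definition net :: "('v, 'e) mgraph \<Rightarrow> ('e \<Rightarrow> 'v \<Rightarrow> int) \<Rightarrow> 'v \<Rightarrow> int" where
  "net G g v = (\<Sum>e\<in>edges G. g e v)"

lemma ends_obtain:
  assumes "multigraph G" "e \<in> edges G"
  obtains x y where "ends G e = {x, y}" "x \<noteq> y" "x \<in> verts G" "y \<in> verts G"
  using assms unfolding multigraph_def by (metis card_2_iff insert_subset)

lemma cut_edge_obtain:
  assumes "multigraph G" "e \<in> cut G X"
  obtains x y where "ends G e = {x, y}" "x \<in> X" "y \<notin> X" "x \<in> verts G" "y \<in> verts G" "e \<in> edges G"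
proof -
  have e: "e \<in> edges G" "card (ends G e \<inter> X) = 1" using assms by (auto simp: cut_def)
  obtain x y where xy: "ends G e = {x, y}" "x \<noteq> y" "x \<in> verts G" "y \<in> verts G"
    using ends_obtain assms e by metis
  consider "x \<in> X" "y \<in> X" | "x \<in> X" "y \<notin> X" | "x \<notin> X" "y \<in> X" | "x \<notin> X" "y \<notin> X" by blast
  then show thesis
  proof cases
    case 1
    then have "ends G e \<inter> X = {x, y}" using xy by auto
    then show ?thesis using e xy by simp
  next
    case 2
    then show ?thesis using that xy e by blast
  next
    case 3
    then show ?thesis using that[of y x] xy e by blast
  next
    case 4
    then have "ends G e \<inter> X = {}" using xy by auto
    then show ?thesis using e xy by simp
  qed
qed

lemma in_cut_iff:
  assumes "multigraph G" "e \<in> edges G" "ends G e = {x, y}"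
  shows "e \<in> cut G X \<longleftrightarrow> (x \<in> X) \<noteq> (y \<in> X)"
proof -
  have *: "ends G e \<inter> X = (if x \<in> X then {x} else {}) \<union> (if y \<in> X then {y} else {})"
    using assms by auto
  have "x \<noteq> y" using assms by (auto simp: multigraph_def)
  then show ?thesis using assms(2) unfolding cut_def mem_Collect_eq * by auto
qed

text \<open>An edge with both ends in \<open>X\<close> contributes two opposite amounts, so only the
  edges of the cut survive.\<close>

lemma net_sum_cut:
  assumes G: "multigraph G" and g: "unit_flow G g" and X: "X \<subseteq> verts G"
  shows "(\<Sum>v\<in>X. net G g v) = (\<Sum>e\<in>cut G X. \<Sum>v\<in>ends G e \<inter> X. g e v)"
proof -
  have fin: "finite (edges G)" "finite X" using G X finite_subset by (auto simp: multigraph_def)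
  have "(\<Sum>v\<in>X. net G g v) = (\<Sum>e\<in>edges G. \<Sum>v\<in>X. g e v)"
    unfolding net_def by (rule sum.swap)
  also have "\<dots> = (\<Sum>e\<in>edges G. \<Sum>v\<in>ends G e \<inter> X. g e v)"
    using g fin by (intro sum.cong sum.mono_neutral_right) (auto simp: unit_flow_def)
  also have "\<dots> = (\<Sum>e\<in>cut G X. \<Sum>v\<in>ends G e \<inter> X. g e v)"
  proof (intro sum.mono_neutral_right ballI)
    fix e assume e: "e \<in> edges G - cut G X"
    then obtain x y where xy: "ends G e = {x, y}" using ends_obtain G by (metis DiffD1)
    then have "(x \<in> X) = (y \<in> X)" using in_cut_iff[OF G _ xy] e by (metis DiffD1 DiffD2)
    then have "ends G e \<inter> X = {} \<or> ends G e \<inter> X = ends G e" using xy by auto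
    then show "(\<Sum>v\<in>ends G e \<inter> X. g e v) = 0" using g e by (auto simp: unit_flow_def)
  qed (use fin in \<open>auto simp: cut_def\<close>)
  finally show ?thesis .
qed

text \<open>With \<open>r = 1\<close> this augments the flow, with \<open>r = - 1\<close> it removes a path from the flow.\<close>

lemma shift_flow_along_epath:
  assumes "epath G c w u vs es" "multigraph G" "unit_flow G g"
    and "\<And>e x. e \<in> edges G \<Longrightarrow> x \<in> ends G e \<Longrightarrow> c e x \<Longrightarrow> \<bar>g e x + r\<bar> \<le> 1"
  shows "\<exists>g'. unit_flow G g' \<and> (\<forall>e. e \<notin> set es \<longrightarrow> g' e = g e) \<and>
    (\<forall>e\<in>set es. \<exists>x\<in>ends G e. c e x \<and> g' e x = g e x + r) \<and>
    (\<forall>v. net G g' v = net G g v + r * (of_bool (v = u) - of_bool (v = w)))"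
  using assms(1)
proof induction
  case epath_nil
  then show ?case using assms by (intro exI[of _ g]) auto
next
  case (epath_cons e x y vs es)
  then obtain g' where g': "unit_flow G g'" "\<And>e. e \<notin> set es \<Longrightarrow> g' e = g e"
    "\<And>e. e \<in> set es \<Longrightarrow> \<exists>x\<in>ends G e. c e x \<and> g' e x = g e x + r"
    "\<And>v. net G g' v = net G g v + r * (of_bool (v = y) - of_bool (v = w))" by blast
  \<comment> \<open>Since \<open>x\<close> is not on the tail, \<open>e\<close> occurs once on the
    path, and its new value can be computed from \<open>g e\<close> rather than from
    \<open>g' e\<close>.\<close>
  have e: "e \<notin> set es" using epath_shape[OF epath_cons.hyps(5)] epath_cons.hyps by auto
  have ne: "x \<noteq> y" using epath_cons.hyps assms(2) by (auto simp: multigraph_def)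
  have fin: "finite (edges G)" using assms(2) by (simp add: multigraph_def)
  define g'' where "g'' = g'(e := (\<lambda>v. g e v + r * (of_bool (v = x) - of_bool (v = y))))"
  have sum0: "g e x + g e y = 0" 
    using assms(3) epath_cons.hyps ne by (auto simp: unit_flow_def)
  have xr: "\<bar>g e x + r\<bar> \<le> 1" using assms(4) epath_cons.hyps by auto
  have "unit_flow G g''"
    unfolding unit_flow_def
  proof (intro ballI)
    fix f assume f: "f \<in> edges G"
    show "(\<forall>v. v \<notin> ends G f \<longrightarrow> g'' f v = 0) \<and> (\<forall>v. \<bar>g'' f v\<bar> \<le> 1) \<and> (\<Sum>v\<in>ends G f. g'' f v) = 0"
    proof (cases "f = e")
      case True
      have *: "\<bar>g e v\<bar> \<le> 1" "v \<notin> ends G e \<Longrightarrow> g e v = 0" for v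
        using assms(3) f True by (auto simp: unit_flow_def)
      have "\<bar>g e v + r * (of_bool (v = x) - of_bool (v = y))\<bar> \<le> 1" for v
        using *(1)[of v] xr sum0 ne by auto
      then show ?thesis using True * sum0 ne epath_cons.hyps(2) by (auto simp: g''_def)
    next
      case False
      then show ?thesis using g'(1) f by (simp add: unit_flow_def g''_def)
    qed
  qed
  moreover have "\<forall>f. f \<notin> set (e # es) \<longrightarrow> g'' f = g f" using g' by (auto simp: g''_def)
  moreover have "\<forall>f\<in>set (e # es). \<exists>x\<in>ends G f. c f x \<and> g'' f x = g f x + r"
    using g'(3) epath_cons.hyps ne by (auto simp: g''_def)
  moreover have "net G g'' v = net G g v + r * (of_bool (v = x) - of_bool (v = w))" for v
  proof -
    have "net G g'' v = (\<Sum>f\<in>edges G. g' f v + (if f = e then r * (of_bool (v = x) - of_bool (v = y)) else 0))"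
      unfolding net_def using g'(2)[OF e] by (intro sum.cong) (auto simp: g''_def)
    also have "\<dots> = net G g' v + r * (of_bool (v = x) - of_bool (v = y))"
      using fin epath_cons.hyps(1) by (simp add: sum.distrib net_def)
    finally show ?thesis using g'(4)[of v] by (simp add: algebra_simps)
  qed
  ultimately show ?case by blast
qed

text \<open>\<open>X\<close> collects the vertices from which \<open>w\<close> cannot be reached
  along steps allowed by \<open>c\<close>; an allowed step out of \<open>X\<close> would give such a
  route. The condition \<open>c\<close> stays abstract so that the argument serves both for
  augmenting a flow and for decomposing one.\<close>

lemma no_epath_cut:
  assumes G: "multigraph G" and g: "unit_flow G g" and w: "w \<in> verts G" and u: "u \<in> verts G"
    and net: "\<And>v. v \<in> verts G \<Longrightarrow> net G g v = j * (of_bool (v = u) - of_bool (v = w))"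
    and no: "\<And>vs es. \<not> epath G c w u vs es"
  obtains X where "X \<subseteq> verts G" "u \<in> X" "w \<notin> X"
    "(\<Sum>e\<in>cut G X. \<Sum>v\<in>ends G e \<inter> X. g e v) = j"
    "\<And>e x y. e \<in> edges G \<Longrightarrow> ends G e = {x, y} \<Longrightarrow> x \<in> X \<Longrightarrow> y \<notin> X \<Longrightarrow> \<not> c e x"
proof -
  define X where "X = {x \<in> verts G. \<forall>vs es. \<not> epath G c w x vs es}"
  have 1: "X \<subseteq> verts G" "u \<in> X" "w \<notin> X" using no u epath_nil[OF w, of c] by (auto simp: X_def)
  have fin: "finite X" using 1 G finite_subset by (auto simp: multigraph_def)
  have "(\<Sum>v\<in>X. net G g v) = (\<Sum>v\<in>X. if v = u then j else 0)"
    using 1 net by (intro sum.cong) auto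
  also have "\<dots> = j" using fin 1 by simp
  finally have 2: "(\<Sum>e\<in>cut G X. \<Sum>v\<in>ends G e \<inter> X. g e v) = j"
    using net_sum_cut[OF G g 1(1)] by simp
  have "\<not> c e x" if e: "e \<in> edges G" "ends G e = {x, y}" "x \<in> X" "y \<notin> X" for e x y
  proof
    assume "c e x"
    have "y \<in> verts G" using e G unfolding multigraph_def by auto
    then obtain vs es where "epath G c w y vs es" using e X_def by blast
    then show False using epath_extend[of G c w y vs es e x] e \<open>c e x\<close> X_def by blast
  qed
  then show thesis using that 1 2 by blast
qed

lemma unit_flow_of_cuts:
  assumes G: "multigraph G" and u: "u \<in> verts G" and w: "w \<in> verts G" and ne: "u \<noteq> w"
    and cuts: "\<And>X. X \<subseteq> verts G \<Longrightarrow> u \<in> X \<Longrightarrow> w \<notin> X \<Longrightarrow> k \<le> card (cut G X)"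
    and "j \<le> k"
  shows "\<exists>g. unit_flow G g \<and> (\<forall>v\<in>verts G. net G g v = int j * (of_bool (v = u) - of_bool (v = w)))"
  using \<open>j \<le> k\<close>
proof (induction j)
  case 0
  show ?case by (intro exI[of _ "\<lambda>e v. 0"]) (simp add: unit_flow_def net_def)
next
  case (Suc j)
  then obtain g where g: "unit_flow G g"
    "\<And>v. v \<in> verts G \<Longrightarrow> net G g v = int j * (of_bool (v = u) - of_bool (v = w))" by auto
  \<comment> \<open>Residual steps: the amount taken out of \<open>x\<close> along \<open>e\<close>
    can still grow by one. Without an augmenting path every edge of the cut of \<open>X\<close> is
    saturated outwards, so the cut has at most \<open>j < k\<close> edges.\<close>
  define c where "c = (\<lambda>e x. g e x \<le> 0)"
  have "\<exists>vs es. epath G c w u vs es"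
  proof (rule ccontr)
    assume "\<not> ?thesis"
    then have no: "\<not> epath G c w u vs es" for vs es by blast
    obtain X where X: "X \<subseteq> verts G" "u \<in> X" "w \<notin> X"
      "(\<Sum>e\<in>cut G X. \<Sum>v\<in>ends G e \<inter> X. g e v) = int j"
      "\<And>e x y. e \<in> edges G \<Longrightarrow> ends G e = {x, y} \<Longrightarrow> x \<in> X \<Longrightarrow> y \<notin> X \<Longrightarrow> \<not> c e x"
      using no_epath_cut[OF G g(1) w u g(2) no] by blast
    have "(\<Sum>e\<in>cut G X. \<Sum>v\<in>ends G e \<inter> X. g e v) \<ge> (\<Sum>e\<in>cut G X. 1)"
    proof (rule sum_mono)
      fix e assume "e \<in> cut G X"
      then obtain x y where xy: "ends G e = {x, y}" "x \<in> X" "y \<notin> X" "e \<in> edges G"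
        using cut_edge_obtain[OF G] by metis
      then have "\<not> c e x" using X(5) by blast
      moreover have "ends G e \<inter> X = {x}" using xy by auto
      ultimately show "1 \<le> (\<Sum>v\<in>ends G e \<inter> X. g e v)" by (simp add: c_def)
    qed
    then show False using X cuts[of X] Suc.prems by simp
  qed
  then obtain vs es where p: "epath G c w u vs es" by blast
  have "\<bar>g e x + 1\<bar> \<le> 1" if "e \<in> edges G" "c e x" for e x
  proof -
    have "\<bar>g e x\<bar> \<le> 1" using g(1) that(1) by (auto simp: unit_flow_def)
    then show ?thesis using that(2) by (auto simp: c_def)
  qed
  then obtain g' where g': "unit_flow G g'"
    "\<And>v. net G g' v = net G g v + 1 * (of_bool (v = u) - of_bool (v = w))"
    using shift_flow_along_epath[OF p G g(1), of 1] by blast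
  have "net G g' v = int (Suc j) * (of_bool (v = u) - of_bool (v = w))" if "v \<in> verts G" for v
    using g(2)[OF that] g'(2)[of v] by (auto simp: algebra_simps)
  then show ?case using g'(1) by blast
qed

text \<open>Paths are peeled off one at a time. The support clause carries the induction: later
  paths use only edges with nonzero remaining flow, and the removed path has none left.\<close>

lemma flow_edge_disjoint_paths:
  assumes G: "multigraph G" and u: "u \<in> verts G" and w: "w \<in> verts G"
    and "unit_flow G g" "\<And>v. v \<in> verts G \<Longrightarrow> net G g v = int j * (of_bool (v = u) - of_bool (v = w))"
  shows "\<exists>vs es. (\<forall>i<j. mpath G u w (vs i) (es i) \<and> (\<forall>e\<in>set (es i). \<exists>v. g e v \<noteq> 0)) \<and>
    (\<forall>i<j. \<forall>i'<j. i \<noteq> i' \<longrightarrow> set (es i) \<inter> set (es i') = {})"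
  using assms(4,5)
proof (induction j arbitrary: g)
  case 0
  then show ?case by simp
next
  case (Suc j)
  note g = Suc.prems
  \<comment> \<open>Steps that follow the flow. If they do not lead from \<open>u\<close> to
    \<open>w\<close>, no flow leaves \<open>X\<close>, although its net outflow is
    \<open>Suc j\<close>.\<close>
  define c where "c = (\<lambda>e x. g e x = 1)"
  have "\<exists>vs es. epath G c w u vs es"
  proof (rule ccontr)
    assume "\<not> ?thesis"
    then have no: "\<not> epath G c w u vs es" for vs es by blast
    obtain X where X: "X \<subseteq> verts G" "u \<in> X" "w \<notin> X"
      "(\<Sum>e\<in>cut G X. \<Sum>v\<in>ends G e \<inter> X. g e v) = int (Suc j)"
      "\<And>e x y. e \<in> edges G \<Longrightarrow> ends G e = {x, y} \<Longrightarrow> x \<in> X \<Longrightarrow> y \<notin> X \<Longrightarrow> \<not> c e x"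
      using no_epath_cut[OF G g(1) w u g(2) no] by blast
    have "(\<Sum>e\<in>cut G X. \<Sum>v\<in>ends G e \<inter> X. g e v) \<le> 0"
    proof (rule sum_nonpos)
      fix e assume "e \<in> cut G X"
      then obtain x y where xy: "ends G e = {x, y}" "x \<in> X" "y \<notin> X" "e \<in> edges G"
        using cut_edge_obtain[OF G] by metis
      then have "\<not> c e x" using X(5) by blast
      moreover have "\<bar>g e x\<bar> \<le> 1" using g(1) xy by (auto simp: unit_flow_def)
      moreover have "ends G e \<inter> X = {x}" using xy by auto
      ultimately show "(\<Sum>v\<in>ends G e \<inter> X. g e v) \<le> 0" by (auto simp: c_def)
    qed
    then show False using X by simp
  qed
  then obtain vs es where p: "epath G c w u vs es" by blast
  have "\<bar>g e x + - 1\<bar> \<le> 1" if "c e x" for e x using that by (simp add: c_def)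
  then obtain g' where g': "unit_flow G g'" "\<And>e. e \<notin> set es \<Longrightarrow> g' e = g e"
    "\<And>e. e \<in> set es \<Longrightarrow> \<exists>x\<in>ends G e. c e x \<and> g' e x = g e x + - 1"
    "\<And>v. net G g' v = net G g v + - 1 * (of_bool (v = u) - of_bool (v = w))"
    using shift_flow_along_epath[OF p G g(1), of "- 1"] by blast
  have es: "set es \<subseteq> edges G" using epath_shape[OF p] by simp
  \<comment> \<open>Removing the path cancels the flow of each of its edges at one end, and the two
    ends carry opposite amounts.\<close>
  have zero: "g' e v = 0" if e: "e \<in> set es" for e v
  proof -
    obtain x where x: "x \<in> ends G e" "g' e x = 0" using g'(3)[OF e] by (auto simp: c_def)
    have eG: "e \<in> edges G" using es e by blast
    obtain a b where ab: "ends G e = {a, b}" "a \<noteq> b" using ends_obtain[OF G eG] by metis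
    have "(\<Sum>v\<in>ends G e. g' e v) = 0" using g'(1) eG unfolding unit_flow_def by blast
    then have "g' e a + g' e b = 0" using ab by simp
    then have "g' e a = 0 \<and> g' e b = 0" using x ab by auto
    moreover have "v \<notin> ends G e \<Longrightarrow> g' e v = 0" using g'(1) es e unfolding unit_flow_def by blast
    ultimately show ?thesis using ab by auto
  qed
  have net': "net G g' v = int j * (of_bool (v = u) - of_bool (v = w))" if "v \<in> verts G" for v
    using g'(4)[of v] g(2)[OF that] by (auto simp: algebra_simps)
  obtain vs' es' where "(\<forall>i<j. mpath G u w (vs' i) (es' i) \<and> (\<forall>e\<in>set (es' i). \<exists>v. g' e v \<noteq> 0)) \<and>
    (\<forall>i<j. \<forall>i'<j. i \<noteq> i' \<longrightarrow> set (es' i) \<inter> set (es' i') = {})"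
    using Suc.IH[OF g'(1) net'] by blast
  then have IH: "\<And>i. i < j \<Longrightarrow> mpath G u w (vs' i) (es' i)"
    "\<And>i. i < j \<Longrightarrow> (\<forall>e\<in>set (es' i). \<exists>v. g' e v \<noteq> 0)"
    "\<And>i i'. i < j \<Longrightarrow> i' < j \<Longrightarrow> i \<noteq> i' \<Longrightarrow> set (es' i) \<inter> set (es' i') = {}"
    by simp_all
  have disj: "set (es' i) \<inter> set es = {}" if "i < j" for i using IH(2)[OF that] zero by blast
  have disj': "set es \<inter> set (es' i) = {}" if "i < j" for i using disj[OF that] by blast
  have supp: "\<exists>v. g e v \<noteq> 0" if "e \<in> set es" for e
    using g'(3)[OF that] unfolding c_def by (metis zero_neq_one)
  have supp': "\<exists>v. g e v \<noteq> 0" if "i < j" "e \<in> set (es' i)" for e i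
    using IH(2)[OF that(1)] disj[OF that(1)] that(2) g'(2)[of e] by force
  show ?case
    using IH(1,3) disj disj' supp supp' epath_mpath[OF p]
    by (intro exI[of _ "vs'(j := vs)"] exI[of _ "es'(j := es)"]) (auto simp: less_Suc_eq)
qed

theorem edge_menger:
  assumes G: "multigraph G" and u: "u \<in> verts G" and w: "w \<in> verts G" and ne: "u \<noteq> w"
  shows "edge_disjoint_paths G k u w \<longleftrightarrow>
    (\<forall>X. X \<subseteq> verts G \<and> u \<in> X \<and> w \<notin> X \<longrightarrow> k \<le> card (cut G X))"
proof
  assume "\<forall>X. X \<subseteq> verts G \<and> u \<in> X \<and> w \<notin> X \<longrightarrow> k \<le> card (cut G X)"
  then obtain g where "unit_flow G g"
    "\<And>v. v \<in> verts G \<Longrightarrow> net G g v = int k * (of_bool (v = u) - of_bool (v = w))"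
    using unit_flow_of_cuts[OF G u w ne, of k k] by auto
  from flow_edge_disjoint_paths[OF G u w this]
  show "edge_disjoint_paths G k u w" unfolding edge_disjoint_paths_def by blast
next
  assume "edge_disjoint_paths G k u w"
  then obtain vs es where p: "\<And>i. i < k \<Longrightarrow> mpath G u w (vs i) (es i)"
    and disj: "\<And>i j. i < k \<Longrightarrow> j < k \<Longrightarrow> i \<noteq> j \<Longrightarrow> set (es i) \<inter> set (es j) = {}"
    unfolding edge_disjoint_paths_def by metis
  show "\<forall>X. X \<subseteq> verts G \<and> u \<in> X \<and> w \<notin> X \<longrightarrow> k \<le> card (cut G X)"
  proof (intro allI impI, elim conjE)
    fix X assume X: "X \<subseteq> verts G" "u \<in> X" "w \<notin> X"
    have "\<exists>e\<in>set (es i). e \<in> cut G X" if "i < k" for i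
    proof -
      have m: "length (vs i) = length (es i) + 1" "hd (vs i) = u" "last (vs i) = w"
        "\<And>j. j < length (es i) \<Longrightarrow> es i ! j \<in> edges G \<and> ends G (es i ! j) = {vs i ! j, vs i ! Suc j}"
        using p[OF that] by (auto simp: mpath_def)
      have "vs i \<noteq> []" using m(1) by auto
      then have st: "vs i ! 0 \<in> X" "vs i ! length (es i) \<notin> X"
        using m X by (simp_all add: hd_conv_nth last_conv_nth)
      have "\<exists>j<length (es i). vs i ! j \<in> X \<and> vs i ! Suc j \<notin> X"
      proof (rule ccontr)
        assume no: "\<not> ?thesis"
        have "j \<le> length (es i) \<Longrightarrow> vs i ! j \<in> X" for j
          by (induction j) (use st no in auto)
        then show False using st by blast
      qed
      then obtain j where "j < length (es i)" "vs i ! j \<in> X" "vs i ! Suc j \<notin> X" by blast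
      then show ?thesis using m(4)[of j] in_cut_iff[OF G, of "es i ! j"] by (metis nth_mem)
    qed
    then obtain h where h: "\<And>i. i < k \<Longrightarrow> h i \<in> set (es i) \<and> h i \<in> cut G X" by metis
    have "inj_on h {..<k}" using h disj by (intro inj_onI) (metis IntI empty_iff lessThan_iff)
    then have "card (h ` {..<k}) = k" by (simp add: card_image)
    moreover have "h ` {..<k} \<subseteq> cut G X" using h by auto
    moreover have "finite (cut G X)" using G by (auto simp: cut_def multigraph_def)
    ultimately show "k \<le> card (cut G X)" by (metis card_mono)
  qed
qed

section \<open>Cuts, liftings and dangerous sets\<close>

lemma cut_complement:
  assumes "multigraph G"
  shows "cut G (verts G - X) = cut G X"
proof -
  have "e \<in> cut G (verts G - X) \<longleftrightarrow> e \<in> cut G X" if e: "e \<in> edges G" for e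
  proof -
    obtain x y where "ends G e = {x, y}" "x \<in> verts G" "y \<in> verts G"
      using ends_obtain[OF assms e] by metis
    then show ?thesis using in_cut_iff[OF assms e] by auto
  qed
  then show ?thesis by (auto simp: cut_def)
qed

lemma finite_cut: "multigraph G \<Longrightarrow> finite (cut G X)"
  by (auto simp: cut_def multigraph_def)

text \<open>A set separating \<open>u\<close> from \<open>w\<close> may contain \<open>s\<close>,
  but then its complement has the same cut and avoids \<open>s\<close>.\<close>

lemma sk_edge_connected_iff_cuts:
  assumes "multigraph G"
  shows "sk_edge_connected G s k \<longleftrightarrow> card (verts G) \<ge> 3 \<and> s \<in> verts G \<and> k > 0 \<and>
    (\<forall>X. X \<subseteq> verts G - {s} \<and> X \<noteq> {} \<and> X \<noteq> verts G - {s} \<longrightarrow> k \<le> card (cut G X))"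
proof -
  have "(\<forall>u \<in> verts G - {s}. \<forall>w \<in> verts G - {s}. u \<noteq> w \<longrightarrow> edge_disjoint_paths G k u w) \<longleftrightarrow>
    (\<forall>X. X \<subseteq> verts G - {s} \<and> X \<noteq> {} \<and> X \<noteq> verts G - {s} \<longrightarrow> k \<le> card (cut G X))" (is "?l \<longleftrightarrow> ?r")
  proof
    assume l: ?l
    show ?r
    proof (intro allI impI, elim conjE)
      fix X assume X: "X \<subseteq> verts G - {s}" "X \<noteq> {}" "X \<noteq> verts G - {s}"
      then obtain u w where uw: "u \<in> X" "w \<in> verts G - {s}" "w \<notin> X" by blast
      then have "edge_disjoint_paths G k u w" using l[rule_format, of u w] X by auto
      then show "k \<le> card (cut G X)"
        using edge_menger[OF assms, of u w k, THEN iffD1, rule_format, of X] uw X by auto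
    qed
  next
    assume r: ?r
    show ?l
    proof (intro ballI impI)
      fix u w assume uw: "u \<in> verts G - {s}" "w \<in> verts G - {s}" "u \<noteq> w"
      have "k \<le> card (cut G X)" if X: "X \<subseteq> verts G" "u \<in> X" "w \<notin> X" for X
      proof (cases "s \<in> X")
        case True
        have "k \<le> card (cut G (verts G - X))"
          using r[rule_format, of "verts G - X"] True X uw by auto
        then show ?thesis by (simp add: cut_complement[OF assms])
      next
        case False
        then show ?thesis using r[rule_format, of X] X uw by auto
      qed
      then show "edge_disjoint_paths G k u w" using edge_menger[OF assms, of u w k, THEN iffD2] uw by simp
    qed
  qed
  then show ?thesis by (simp add: sk_edge_connected_def)
qed

section \<open>Edges at \<open>s\<close> and the effect of a lift on cuts\<close>

lemma ends_incident_edge: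
  assumes "multigraph G" "e \<in> cut G {s}"
  shows "ends G e = {s, far_end G s e}" "far_end G s e \<noteq> s" "far_end G s e \<in> verts G"
    "e \<in> edges G"
proof -
  obtain x y where *: "ends G e = {x, y}" "x \<in> {s}" "y \<notin> {s}" "y \<in> verts G" "e \<in> edges G"
    using cut_edge_obtain[OF assms] by metis
  then have "far_end G s e = y" unfolding far_end_def by (intro the_equality) auto
  then show "ends G e = {s, far_end G s e}" "far_end G s e \<noteq> s" "far_end G s e \<in> verts G"
    "e \<in> edges G" using * by auto
qed

lemma incident_edge_in_cut:
  assumes "multigraph G" "e \<in> cut G {s}" "s \<notin> X"
  shows "e \<in> cut G X \<longleftrightarrow> far_end G s e \<in> X"
  using in_cut_iff[OF assms(1)] ends_incident_edge[OF assms(1,2)] assms(3) by metis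

lemma verts_lift [simp]: "verts (lift G s e f) = verts G"
  by (simp add: lift_def)

lemma multigraph_lift:
  assumes "multigraph G" "e \<in> cut G {s}" "f \<in> cut G {s}"
  shows "multigraph (lift G s e f)"
  using assms(1) ends_incident_edge[OF assms(1,2)] ends_incident_edge[OF assms(1,3)]
  by (auto simp: multigraph_def lift_def)

text \<open>If both far ends are in \<open>X\<close>, both edges leave the cut and nothing replaces
  them. If exactly one is, the new edge replaces the lost one. Equal far ends can only give the
  first case or no change.\<close>

lemma card_cut_lift:
  assumes G: "multigraph G" and e: "e \<in> cut G {s}" and f: "f \<in> cut G {s}" and ne: "e \<noteq> f"
    and X: "s \<notin> X"
  shows "card (cut G X) =
    card (cut (lift G s e f) X) + (if far_end G s e \<in> X \<and> far_end G s f \<in> X then 2 else 0)"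
proof -
  let ?v = "far_end G s e" and ?w = "far_end G s f" and ?H = "lift G s e f"
  note fin = finite_cut[OF G, of X]
  note H = multigraph_lift[OF G e f]
  have eG: "e \<in> cut G X \<longleftrightarrow> ?v \<in> X" and fG: "f \<in> cut G X \<longleftrightarrow> ?w \<in> X"
    using incident_edge_in_cut[OF G _ X] e f by auto
  have eH: "e \<in> cut ?H X \<longleftrightarrow> ?v \<noteq> ?w \<and> (?v \<in> X) \<noteq> (?w \<in> X)"
  proof (cases "?v = ?w")
    case True
    then show ?thesis by (simp add: lift_def cut_def)
  next
    case False
    then have "e \<in> edges ?H" "ends ?H e = {?v, ?w}"
      using ends_incident_edge[OF G e] ne by (auto simp: lift_def)
    then show ?thesis using in_cut_iff[OF H] False by auto
  qed
  have fH: "f \<notin> cut ?H X" by (auto simp: lift_def cut_def)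
  have rest: "g \<in> cut ?H X \<longleftrightarrow> g \<in> cut G X" if "g \<noteq> e" "g \<noteq> f" for g
    using that by (auto simp: lift_def cut_def)
  consider "?v \<in> X" "?w \<in> X" | "?v \<in> X" "?w \<notin> X" | "?v \<notin> X" "?w \<in> X" | "?v \<notin> X" "?w \<notin> X" by blast
  then show ?thesis
  proof cases
    case 1
    then have "x \<in> cut G X \<longleftrightarrow> x = e \<or> x = f \<or> x \<in> cut ?H X" for x
      using eG fG rest by metis
    then have "cut G X = insert e (insert f (cut ?H X))" by blast
    moreover have "e \<notin> cut ?H X" using 1 eH by blast
    ultimately show ?thesis using 1 fH ne fin by simp
  next
    case 2
    then have "x \<in> cut G X \<longleftrightarrow> x \<in> cut ?H X" for x using eG fG eH fH rest by metis
    then have "cut G X = cut ?H X" by blast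
    then show ?thesis using 2 by simp
  next
    case 3
    then have "x \<in> cut ?H X \<longleftrightarrow> x = e \<or> x \<in> cut G X \<and> x \<noteq> f" for x
      using eG fG eH fH rest by metis
    then have "cut ?H X = insert e (cut G X - {f})" by blast
    moreover have "cut G X = insert f (cut G X - {f})" "e \<notin> cut G X" using 3 eG fG by auto
    ultimately have "card (cut G X) = Suc (card (cut G X - {f}))" "card (cut ?H X) = Suc (card (cut G X - {f}))"
      using fin by (metis DiffD1 DiffD2 card_insert_disjoint finite_Diff insertI1)+
    then show ?thesis using 3 by simp
  next
    case 4
    then have "x \<in> cut G X \<longleftrightarrow> x \<in> cut ?H X" for x using eG fG eH fH rest by metis
    then have "cut G X = cut ?H X" by blast
    then show ?thesis using 4 by simp
  qed
qed

section \<open>Counting edges between blocks\<close>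

lemma cut_between_commute: "cut_between G X Y = cut_between G Y X"
  unfolding cut_between_def by (auto simp: insert_commute)

lemma finite_cut_between: "multigraph G \<Longrightarrow> finite (cut_between G X Y)"
  by (auto simp: cut_between_def multigraph_def)

lemma in_cut_between_iff:
  assumes "e \<in> edges G" "ends G e = {x, y}"
  shows "e \<in> cut_between G X Y \<longleftrightarrow> x \<in> X \<and> y \<in> Y \<or> y \<in> X \<and> x \<in> Y"
  using assms by (auto simp: cut_between_def doubleton_eq_iff)

lemma cut_between_obtain:
  assumes "e \<in> cut_between G X Y"
  obtains x y where "e \<in> edges G" "ends G e = {x, y}" "x \<in> X" "y \<in> Y"
  using assms by (auto simp: cut_between_def)

lemma cut_eq_cut_between:
  assumes "multigraph G"
  shows "cut G X = cut_between G X (verts G - X)"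
proof -
  have "e \<in> cut G X \<longleftrightarrow> e \<in> cut_between G X (verts G - X)" if e: "e \<in> edges G" for e
  proof -
    obtain x y where xy: "ends G e = {x, y}" "x \<in> verts G" "y \<in> verts G"
      using ends_obtain[OF assms e] by metis
    then show ?thesis using in_cut_iff[OF assms e xy(1)] in_cut_between_iff[OF e xy(1)] by auto
  qed
  then show ?thesis by (auto simp: cut_def cut_between_def)
qed

lemma cut_between_Un: "cut_between G (X \<union> Y) Z = cut_between G X Z \<union> cut_between G Y Z"
  by (auto simp: cut_between_def)

lemma card_cut_between_Un:
  assumes "multigraph G" "X \<inter> Y = {}" "X \<inter> Z = {}" "Y \<inter> Z = {}"
  shows "card (cut_between G (X \<union> Y) Z) = card (cut_between G X Z) + card (cut_between G Y Z)"
    and "card (cut_between G Z (X \<union> Y)) = card (cut_between G Z X) + card (cut_between G Z Y)"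
proof -
  have "cut_between G X Z \<inter> cut_between G Y Z = {}"
    using assms(2-4) by (fastforce simp: cut_between_def doubleton_eq_iff)
  then show "card (cut_between G (X \<union> Y) Z) = card (cut_between G X Z) + card (cut_between G Y Z)"
    by (simp add: cut_between_Un card_Un_disjoint finite_cut_between[OF assms(1)])
  then show "card (cut_between G Z (X \<union> Y)) = card (cut_between G Z X) + card (cut_between G Z Y)"
    by (simp add: cut_between_commute[of G Z])
qed

lemma cut_between_mono: "X \<subseteq> X' \<Longrightarrow> Y \<subseteq> Y' \<Longrightarrow> cut_between G X Y \<subseteq> cut_between G X' Y'"
  by (auto simp: cut_between_def)

text \<open>Two sets divide the vertices into four cells, and every cut needed is a sum of some of
  the six counts between cells. Uncrossing thereby becomes linear arithmetic. The cells enter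
  through equations, so that a caller can either name them or supply \<open>refl\<close>.\<close>

lemma card_cut_cells:
  assumes "multigraph G" "A \<subseteq> verts G" "B \<subseteq> verts G"
    and b_def: "b = (\<lambda>X Y. card (cut_between G X Y))"
    and P: "P = A \<inter> B" and Q: "Q = A - B" and R: "R = B - A" and W: "W = verts G - (A \<union> B)"
  shows "card (cut G A) = b P R + b P W + b Q R + b Q W"
    and "card (cut G B) = b P Q + b P W + b Q R + b R W"
    and "card (cut G P) = b P Q + b P R + b P W"
    and "card (cut G Q) = b P Q + b Q R + b Q W"
    and "card (cut G R) = b P R + b Q R + b R W"
    and "card (cut G (A \<union> B)) = b P W + b Q W + b R W"
proof -
  note un = card_cut_between_Un[OF assms(1)]
  have d: "P \<inter> Q = {}" "P \<inter> R = {}" "P \<inter> W = {}" "Q \<inter> R = {}" "Q \<inter> W = {}" "R \<inter> W = {}"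
    "Q \<inter> P = {}" "R \<inter> P = {}" "W \<inter> P = {}" "R \<inter> Q = {}" "W \<inter> Q = {}" "W \<inter> R = {}"
    unfolding P Q R W by auto
  have comm: "b X Y = b Y X" for X Y unfolding b_def by (simp add: cut_between_commute)
  have "card (cut G A) = b (P \<union> Q) (R \<union> W)"
    unfolding cut_eq_cut_between[OF assms(1)] b_def P Q R W
    by (intro arg_cong2[where f="\<lambda>X Y. card (cut_between G X Y)"]) (use assms in auto)
  then show "card (cut G A) = b P R + b P W + b Q R + b Q W"
    using d by (simp add: b_def un Int_Un_distrib Int_Un_distrib2)
  have "card (cut G B) = b (P \<union> R) (Q \<union> W)"
    unfolding cut_eq_cut_between[OF assms(1)] b_def P Q R W
    by (intro arg_cong2[where f="\<lambda>X Y. card (cut_between G X Y)"]) (use assms in auto)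
  then show "card (cut G B) = b P Q + b P W + b Q R + b R W"
    using d comm[of R Q] by (simp add: b_def un Int_Un_distrib Int_Un_distrib2)
  have "card (cut G P) = b P (Q \<union> (R \<union> W))"
    unfolding cut_eq_cut_between[OF assms(1)] b_def P Q R W
    by (intro arg_cong2[where f="\<lambda>X Y. card (cut_between G X Y)"]) (use assms in auto)
  then show "card (cut G P) = b P Q + b P R + b P W"
    using d by (simp add: b_def un Int_Un_distrib Int_Un_distrib2)
  have "card (cut G Q) = b Q (P \<union> (R \<union> W))"
    unfolding cut_eq_cut_between[OF assms(1)] b_def P Q R W
    by (intro arg_cong2[where f="\<lambda>X Y. card (cut_between G X Y)"]) (use assms in auto)
  then show "card (cut G Q) = b P Q + b Q R + b Q W"
    using d comm[of Q P] by (simp add: b_def un Int_Un_distrib Int_Un_distrib2)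
  have "card (cut G R) = b R (P \<union> (Q \<union> W))"
    unfolding cut_eq_cut_between[OF assms(1)] b_def P Q R W
    by (intro arg_cong2[where f="\<lambda>X Y. card (cut_between G X Y)"]) (use assms in auto)
  then show "card (cut G R) = b P R + b Q R + b R W"
    using d comm[of R P] comm[of R Q] by (simp add: b_def un Int_Un_distrib Int_Un_distrib2)
  have "card (cut G (A \<union> B)) = b (P \<union> (Q \<union> R)) W"
    unfolding cut_eq_cut_between[OF assms(1)] b_def P Q R W
    by (intro arg_cong2[where f="\<lambda>X Y. card (cut_between G X Y)"]) (use assms in auto)
  then show "card (cut G (A \<union> B)) = b P W + b Q W + b R W"
    using d by (simp add: b_def un Int_Un_distrib Int_Un_distrib2)
qed

lemma card_eq_sum_of_bool:
  assumes "finite E" "F \<subseteq> E"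
  shows "card F = (\<Sum>e\<in>E. of_bool (e \<in> F))"
proof -
  have "{x \<in> E. x \<in> F} = F" using assms by auto
  then show ?thesis using assms by (simp add: of_bool_def sum.If_cases Int_def)
qed

text \<open>The inequality holds edge by edge. An edge from \<open>s\<close> into exactly two of the
  sets counts 2 on the right and 0 in the cuts on the left; into all three it counts 3 against 1.
  This slack is the coefficient 2.\<close>

lemma three_set_inequality:
  assumes G: "multigraph G" and s: "s \<notin> A \<union> B \<union> C"
  shows "card (cut G (A \<inter> B \<inter> C)) + card (cut G (A - B - C)) + card (cut G (B - A - C)) +
      card (cut G (C - A - B)) + 2 * card (cut_between G {s} (A \<inter> B \<union> A \<inter> C \<union> B \<inter> C))
    \<le> card (cut G A) + card (cut G B) + card (cut G C)"
proof -
  have fin: "finite (edges G)" using G by (simp add: multigraph_def)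
  have c: "card (cut G X) = (\<Sum>e\<in>edges G. of_bool (e \<in> cut G X))"
    and cb: "card (cut_between G X Y) = (\<Sum>e\<in>edges G. of_bool (e \<in> cut_between G X Y))" for X Y
    by (rule card_eq_sum_of_bool[OF fin]; auto simp: cut_def cut_between_def)+
  show ?thesis
    unfolding c cb sum_distrib_left sum.distrib[symmetric]
  proof (rule sum_mono)
    fix e assume e: "e \<in> edges G"
    obtain x y where xy: "ends G e = {x, y}" "x \<noteq> y" using ends_obtain[OF G e] by metis
    show "of_bool (e \<in> cut G (A \<inter> B \<inter> C)) + of_bool (e \<in> cut G (A - B - C)) +
        of_bool (e \<in> cut G (B - A - C)) + of_bool (e \<in> cut G (C - A - B)) +
        2 * of_bool (e \<in> cut_between G {s} (A \<inter> B \<union> A \<inter> C \<union> B \<inter> C))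
      \<le> (of_bool (e \<in> cut G A) + of_bool (e \<in> cut G B) + of_bool (e \<in> cut G C) :: nat)"
      unfolding in_cut_iff[OF G e xy(1)] in_cut_between_iff[OF e xy(1)]
      using s xy(2)
      by (cases "x \<in> A"; cases "y \<in> A"; cases "x \<in> B"; cases "y \<in> B"; cases "x \<in> C"; cases "y \<in> C"; auto)
  qed
qed

lemma in_cut_between_s_iff:
  assumes "multigraph G" "s \<notin> X"
  shows "e \<in> cut_between G {s} X \<longleftrightarrow> e \<in> cut G {s} \<and> far_end G s e \<in> X"
proof
  assume "e \<in> cut_between G {s} X"
  then obtain y where *: "e \<in> edges G" "ends G e = {s, y}" "y \<in> X" 
    using cut_between_obtain by (metis singletonD)
  then have "e \<in> cut G {s}" using in_cut_iff[OF assms(1), of e s y "{s}"] assms by auto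
  moreover have "far_end G s e = y" using ends_incident_edge[OF assms(1) calculation] * 
    by (auto simp: doubleton_eq_iff)
  ultimately show "e \<in> cut G {s} \<and> far_end G s e \<in> X" using * by simp
next
  assume "e \<in> cut G {s} \<and> far_end G s e \<in> X"
  then show "e \<in> cut_between G {s} X"
    using ends_incident_edge[OF assms(1), of e s] in_cut_between_iff[of e G] by blast
qed

section \<open>Dangerous sets and their crossings\<close>

locale lifting_setting =
  fixes G :: "('v, 'e) mgraph" and s :: 'v and k :: nat
  assumes G: "multigraph G" and conn: "sk_edge_connected G s k" and k2: "k \<ge> 2"
    and deg4: "deg G s \<ge> 4"
begin

abbreviation "d X \<equiv> card (cut G X)"
abbreviation "b X Y \<equiv> card (cut_between G X Y)"
abbreviation "S \<equiv> cut G {s}"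
abbreviation "fe \<equiv> far_end G s"
abbreviation "dang \<equiv> dangerous G s k"
abbreviation "L \<equiv> lifting_graph G s k"

lemma s_in: "s \<in> verts G" using conn by (simp add: sk_edge_connected_def)

lemma cut_ge: "X \<subseteq> verts G - {s} \<Longrightarrow> X \<noteq> {} \<Longrightarrow> X \<noteq> verts G - {s} \<Longrightarrow> k \<le> d X"
  using conn sk_edge_connected_iff_cuts[OF G] by blast

lemma fin_S: "finite S" by (rule finite_cut[OF G])

lemma fe_verts: "e \<in> S \<Longrightarrow> fe e \<in> verts G - {s}"
  using ends_incident_edge[OF G] by blast

lemma dangD:
  assumes "dang A"
  shows "A \<subseteq> verts G" "s \<notin> A" "A \<noteq> {}" "A \<noteq> verts G - {s}" "k \<le> d A" "d A \<le> k + 1"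
  using assms cut_ge[of A] unfolding dangerous_def by auto

text \<open>A lift lowers \<open>d X\<close> by 2, and only for sets containing both far ends. Such
  a set falls below \<open>k\<close> exactly when \<open>d X \<le> k + 1\<close>.\<close>

lemma not_liftable_iff:
  assumes "e \<in> S" "f \<in> S" "e \<noteq> f"
  shows "\<not> liftable G s k e f \<longleftrightarrow> (\<exists>A. dang A \<and> fe e \<in> A \<and> fe f \<in> A)"
proof -
  note lc = card_cut_lift[OF G assms]
  have "liftable G s k e f \<longleftrightarrow>
    (\<forall>X. X \<subseteq> verts G - {s} \<and> X \<noteq> {} \<and> X \<noteq> verts G - {s} \<longrightarrow> k \<le> card (cut (lift G s e f) X))"
    unfolding liftable_def sk_edge_connected_iff_cuts[OF multigraph_lift[OF G assms(1,2)]]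
    using conn by (simp add: sk_edge_connected_def)
  also have "\<dots> \<longleftrightarrow> \<not> (\<exists>A. dang A \<and> fe e \<in> A \<and> fe f \<in> A)"
  proof (intro iffI allI impI notI)
    assume all: "\<forall>X. X \<subseteq> verts G - {s} \<and> X \<noteq> {} \<and> X \<noteq> verts G - {s} \<longrightarrow> k \<le> card (cut (lift G s e f) X)"
    assume "\<exists>A. dang A \<and> fe e \<in> A \<and> fe f \<in> A"
    then obtain A where A: "dang A" "fe e \<in> A" "fe f \<in> A" by blast
    have "k \<le> card (cut (lift G s e f) A)" using all dangD[OF A(1)] by blast
    then show False using lc[of A] A dangD[OF A(1)] by simp
  next
    fix X assume no: "\<not> (\<exists>A. dang A \<and> fe e \<in> A \<and> fe f \<in> A)"
      and X: "X \<subseteq> verts G - {s} \<and> X \<noteq> {} \<and> X \<noteq> verts G - {s}"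
    show "k \<le> card (cut (lift G s e f) X)"
    proof (rule ccontr)
      assume less: "\<not> ?thesis"
      have "s \<notin> X" "k \<le> d X" using X cut_ge[of X] by blast+
      then have both: "fe e \<in> X \<and> fe f \<in> X" using less lc[of X] by (auto split: if_splits)
      then have "d X \<le> k + 1" using less lc[of X] \<open>s \<notin> X\<close> by auto
      then have "dang X" using X by (auto simp: dangerous_def)
      then show False using no both by blast
    qed
  qed
  finally show ?thesis by blast
qed

text \<open>Let \<open>B\<close> be the rest of \<open>verts G - {s}\<close>. The edges between
  \<open>A\<close> and \<open>B\<close> cancel in \<open>d A - d B\<close>, which leaves
  \<open>b {s} A - b {s} B\<close>, and this is at most \<open>(k + 1) - k\<close>.\<close>

lemma dang_two_b_le:
  assumes "dang A"
  shows "2 * b {s} A \<le> deg G s + 1"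
proof -
  note A = dangD[OF assms]
  define B where "B = verts G - A - {s}"
  have B: "B \<subseteq> verts G - {s}" "B \<noteq> {}" "B \<noteq> verts G - {s}"
    using A by (auto simp: B_def)
  have "k \<le> d B" using cut_ge B by blast
  moreover have "verts G - A = {s} \<union> B" "verts G - B = {s} \<union> A" "verts G - {s} = A \<union> B"
    using A s_in by (auto simp: B_def)
  then have "d A = b A {s} + b A B" "d B = b B {s} + b B A" "deg G s = b {s} A + b {s} B"
    unfolding cut_eq_cut_between[OF G] deg_def
    using A by (simp_all only:) (intro card_cut_between_Un[OF G]; auto simp: B_def)+
  ultimately show ?thesis using A
    cut_between_commute[of G A B] cut_between_commute[of G A "{s}"] cut_between_commute[of G B "{s}"] by simp
qed

lemma dang_misses_edge:
  assumes "dang A"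
  shows "\<exists>e\<in>S. fe e \<notin> A"
proof (rule ccontr)
  assume "\<not> ?thesis"
  then have "cut_between G {s} A = S" using in_cut_between_s_iff[OF G, of s A] dangD[OF assms] by auto
  then show False using dang_two_b_le[OF assms] deg4 by (simp add: deg_def)
qed

text \<open>Counting over cells gives \<open>d A + d B = d Q + d R + 2 * b P W\<close>. The left
  side is at most \<open>2 * k + 2\<close>. The right side is at least that: \<open>Q\<close> and
  \<open>R\<close> are nonempty by \<open>nest\<close> and miss \<open>fe e\<close>, while
  \<open>e\<close> runs from \<open>P\<close> to \<open>s\<close>, which lies in \<open>W\<close>.
  So equality holds throughout, and the other conclusions are linear consequences.\<close>

lemma crossing:
  assumes A: "dang A" and B: "dang B" and e: "e \<in> S" "fe e \<in> A" "fe e \<in> B"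
    and nest: "\<not> A \<subseteq> B" "\<not> B \<subseteq> A"
    and P: "P = A \<inter> B" and Q: "Q = A - B" and R: "R = B - A" and W: "W = verts G - (A \<union> B)"
  shows "d A = k + 1" "d B = k + 1" "d Q = k" "d R = k" "cut_between G P W = {e}"
    "b P R = b P Q" "b R W = b Q W" "d P = 2 * b P Q + 1" "d (A \<union> B) = 2 * b Q W + 1"
    "b P Q + b Q R + b Q W = k" "k \<le> d P"
proof -
  note A' = dangD[OF A] and B' = dangD[OF B]
  note cells = card_cut_cells[OF G A'(1) B'(1) refl P Q R W]
  have "fe e \<notin> Q" "fe e \<notin> R" "fe e \<in> verts G" using e fe_verts unfolding Q R by auto
  then have QR: "k \<le> d Q" "k \<le> d R"
    using A' B' nest e fe_verts[OF e(1)] by (intro cut_ge; auto simp: Q R)+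
  have eP: "e \<in> cut_between G P W"
    using ends_incident_edge[OF G e(1)] e in_cut_between_iff[of e G s "fe e" P W] s_in A' B'
    unfolding P W by blast
  have fin: "finite (cut_between G P W)" by (rule finite_cut_between[OF G])
  have ge: "1 \<le> b P W" using eP fin by (metis One_nat_def Suc_leI card_gt_0_iff empty_iff)
  have one: "b P W = 1" using cells A' B' QR ge by linarith
  show "cut_between G P W = {e}" using one eP by (metis card_1_singletonE singletonD)
  show "d A = k + 1" "d B = k + 1" "d Q = k" "d R = k" using cells A' B' QR ge by linarith+
  then show "b P R = b P Q" "b R W = b Q W" "d P = 2 * b P Q + 1" "d (A \<union> B) = 2 * b Q W + 1"
    "b P Q + b Q R + b Q W = k" using cells one by linarith+
  show "k \<le> d P" using A' B' nest e unfolding P by (intro cut_ge) auto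
qed

text \<open>Two edges from \<open>s\<close> into the intersection of crossing sets would both be the
  unique edge from \<open>P\<close> to \<open>W\<close>.\<close>

lemma dang_nested:
  assumes "dang A" "dang B" "e \<in> S" "f \<in> S" "e \<noteq> f" "fe e \<in> A" "fe e \<in> B" "fe f \<in> A" "fe f \<in> B"
  shows "A \<subseteq> B \<or> B \<subseteq> A"
proof (rule ccontr)
  assume "\<not> ?thesis"
  then have n: "\<not> A \<subseteq> B" "\<not> B \<subseteq> A" by blast+
  have "{e} = {f}"
    using crossing(5)[OF assms(1,2,3,6,7) n refl refl refl refl]
      crossing(5)[OF assms(1,2,4,8,9) n refl refl refl refl] by simp
  then show False using assms by simp
qed

end

section \<open>Maximal independent sets as lines\<close>

lemma two_elements:
  assumes "2 \<le> card X"
  obtains x y where "x \<in> X" "y \<in> X" "x \<noteq> y"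
proof -
  obtain Y where "Y \<subseteq> X" "card Y = 2" using obtain_subset_with_card_n[OF assms] by blast
  then show thesis using that unfolding card_2_iff by blast
qed

context lifting_setting begin

lemma dang_subset_ge:
  assumes "dang A" "X \<subseteq> A" "X \<noteq> {}"
  shows "k \<le> d X"
  using assms dangD[OF assms(1)] by (intro cut_ge) auto

lemma dang_subset:
  assumes "dang A" "X \<subseteq> A" "X \<noteq> {}" "d X \<le> k + 1"
  shows "dang X"
  using assms unfolding dangerous_def by auto

text \<open>Crossing sets that share an edge at \<open>s\<close> have cut size \<open>k + 1\<close>,
  not \<open>k\<close>.\<close>

lemma dang_tight_nested:
  assumes "dang X" "d X = k" "dang C" "h \<in> S" "fe h \<in> X" "fe h \<in> C"
  shows "X \<subseteq> C \<or> C \<subseteq> X"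
proof (rule ccontr)
  assume "\<not> ?thesis"
  then have n: "\<not> X \<subseteq> C" "\<not> C \<subseteq> X" by blast+
  show False using crossing(1)[OF assms(1,3,4,5,6) n refl refl refl refl] assms(2) by simp
qed

text \<open>The difference \<open>A - B\<close> has cut size \<open>k\<close>, so it is nested with
  \<open>C\<close>, with which it shares \<open>f\<close>; and \<open>C \<subseteq> A - B\<close>
  contradicts \<open>C'\<close>.\<close>

lemma crossing_diff_subset:
  assumes A: "dang A" and B: "dang B" and C: "dang C"
    and e: "e \<in> S" "fe e \<in> A" "fe e \<in> B" and n: "\<not> A \<subseteq> B" "\<not> B \<subseteq> A"
    and f: "f \<in> S" "fe f \<in> A" "fe f \<notin> B" "fe f \<in> C" and C': "\<not> C \<subseteq> A"
  shows "A - B \<subseteq> C"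
proof -
  have dQ: "d (A - B) = k" using crossing(3)[OF A B e n refl refl refl refl] .
  have "dang (A - B)" by (rule dang_subset[OF A]) (use dQ f in auto)
  then show ?thesis using dang_tight_nested[OF _ dQ C f(1)] f C' by blast
qed

text \<open>If no dangerous set contained all three ends, then each of \<open>A\<close>, \<open>B\<close>, \<open>C\<close> would lie in the union of the other two
  and only \<open>e\<close>, \<open>f\<close>, \<open>g\<close> would leave \<open>A \<union> B\<close>, so that \<open>A \<union> B\<close> would be dangerous.\<close>

lemma triple_dang:
  assumes efg: "e \<in> S" "f \<in> S" "g \<in> S"
    and A: "dang A" "fe e \<in> A" "fe f \<in> A" and B: "dang B" "fe f \<in> B" "fe g \<in> B"
    and C: "dang C" "fe e \<in> C" "fe g \<in> C"
  shows "\<exists>D. dang D \<and> fe e \<in> D \<and> fe f \<in> D \<and> fe g \<in> D"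
proof (rule ccontr)
  assume no: "\<not> ?thesis"
  then have out: "fe g \<notin> A" "fe e \<notin> B" "fe f \<notin> C" using A B C by blast+
  have AB: "\<not> A \<subseteq> B" "\<not> B \<subseteq> A" and AC: "\<not> A \<subseteq> C" "\<not> C \<subseteq> A" and "\<not> B \<subseteq> C" "\<not> C \<subseteq> B"
    using A B C out by blast+
  have Q: "A - B \<subseteq> C"
    by (rule crossing_diff_subset[OF A(1) B(1) C(1) efg(2) A(3) B(2) AB efg(1) A(2) out(2) C(2) AC(2)])
  have R: "C - A \<subseteq> B"
    by (rule crossing_diff_subset[OF C(1) A(1) B(1) efg(1) C(2) A(2) AC(2,1) efg(3) C(3) out(1) B(3) \<open>\<not> B \<subseteq> C\<close>])
  define W where "W = verts G - (A \<union> B)"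
  have "cut_between G (A \<inter> C) (verts G - (A \<union> C)) = {e}"
    by (rule crossing(5)[OF A(1) C(1) efg(1) A(2) C(2) AC refl refl refl refl])
  \<comment> \<open>By \<open>Q\<close> the set \<open>A - B\<close> lies in
    \<open>A \<inter> C\<close>, and by \<open>R\<close> no vertex of \<open>W\<close> lies in
    \<open>C\<close>.\<close>
  moreover have "cut_between G (A - B) W \<subseteq> cut_between G (A \<inter> C) (verts G - (A \<union> C))"
    using Q R by (intro cut_between_mono) (auto simp: W_def)
  ultimately have "b (A - B) W \<le> 1" by (metis card_mono finite.emptyI finite.insertI is_singletonI is_singleton_altdef)
  then have le: "d (A \<union> B) \<le> 3"
    using crossing(9)[OF A(1) B(1) efg(2) A(3) B(2) AB refl refl refl W_def] by simp
  \<comment> \<open>If \<open>A \<union> B\<close> were everything but \<open>s\<close>, its cut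
    would consist of the edges at \<open>s\<close>, of which there are at least 4. Below,
    \<open>k \<ge> 2\<close> turns the bound 3 into \<open>k + 1\<close>.\<close>
  have "A \<union> B \<noteq> verts G - {s}"
    using le deg4 cut_complement[OF G, of "{s}"] by (auto simp: deg_def)
  then have "dang (A \<union> B)"
    using le k2 A(1) B(1) unfolding dangerous_def by auto
  then show False using no A B by blast
qed

text \<open>Take a dangerous \<open>A\<close> covering as many edges of \<open>F\<close> as
  possible; it covers two of them, \<open>x\<close> and \<open>y\<close>. A missed \<open>z\<close>
  yields by \<open>triple_dang\<close> a dangerous \<open>D\<close> over \<open>x\<close>,
  \<open>y\<close>, \<open>z\<close>. Sharing two edges, \<open>A\<close> and \<open>D\<close> are
  nested, so \<open>D\<close> covers everything that \<open>A\<close> does and also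
  \<open>z\<close>.\<close>

lemma clique_dang:
  assumes F: "F \<subseteq> S" "card F \<ge> 2"
    and nl: "\<And>e f. e \<in> F \<Longrightarrow> f \<in> F \<Longrightarrow> e \<noteq> f \<Longrightarrow> \<exists>A. dang A \<and> fe e \<in> A \<and> fe f \<in> A"
  shows "\<exists>A. dang A \<and> fe ` F \<subseteq> A"
proof -
  have fin: "finite F" using F fin_S finite_subset by blast
  define m where "m = (\<lambda>A. card {x \<in> F. fe x \<in> A})"
  have mono: "card X \<le> m A" if "X \<subseteq> F" "fe ` X \<subseteq> A" for X A
    unfolding m_def using that fin by (intro card_mono) auto
  obtain e f where ef: "e \<in> F" "f \<in> F" "e \<noteq> f"
    using two_elements[OF F(2)] by blast
  obtain A0 where A0: "dang A0" "fe e \<in> A0" "fe f \<in> A0" using nl ef by blast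
  have "m A < Suc (card F)" for A unfolding m_def less_Suc_eq_le using fin by (intro card_mono) auto
  then obtain A where A: "dang A" and max: "\<And>B. dang B \<Longrightarrow> m B \<le> m A"
    using ex_has_greatest_nat[of dang A0 m "Suc (card F)"] A0(1) by blast
  have "2 \<le> m A" using mono[of "{e, f}" A0] ef A0 max[OF A0(1)] by auto
  then obtain x y where xy: "x \<in> F" "y \<in> F" "x \<noteq> y" "fe x \<in> A" "fe y \<in> A"
    using two_elements[of "{x \<in> F. fe x \<in> A}"] unfolding m_def by blast
  have "fe z \<in> A" if z: "z \<in> F" for z
  proof (rule ccontr)
    assume nz: "fe z \<notin> A"
    then have "z \<noteq> x" "z \<noteq> y" using xy by auto
    obtain B C where BC: "dang B" "fe y \<in> B" "fe z \<in> B" "dang C" "fe x \<in> C" "fe z \<in> C"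
      using nl[OF xy(2) z] nl[OF xy(1) z] \<open>z \<noteq> x\<close> \<open>z \<noteq> y\<close> by blast
    have S: "x \<in> S" "y \<in> S" "z \<in> S" using xy z F by auto
    obtain D where D: "dang D" "fe x \<in> D" "fe y \<in> D" "fe z \<in> D"
      using triple_dang[OF S A xy(4,5) BC] by blast
    have "A \<subseteq> D" using dang_nested[OF A D(1) S(1,2) xy(3) xy(4) D(2) xy(5) D(3)] D nz by blast
    then have "card (insert z {x \<in> F. fe x \<in> A}) \<le> m D" using D z by (intro mono) auto
    moreover have "card (insert z {x \<in> F. fe x \<in> A}) = Suc (m A)" using fin nz by (simp add: m_def)
    ultimately show False using max[OF D(1)] by simp
  qed
  then show ?thesis using A by blast
qed

section \<open>Independent sets of the lifting graph\<close>

lemma nodes_L: "nodes L = S" by (simp add: lifting_graph_def)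

lemma liftable_sym:
  assumes "e \<in> S" "f \<in> S" "e \<noteq> f"
  shows "liftable G s k e f \<longleftrightarrow> liftable G s k f e"
  using not_liftable_iff[OF assms] not_liftable_iff[OF assms(2,1)] assms(3) by blast

lemma pair_in_links_L_iff:
  assumes "e \<in> S" "f \<in> S" "e \<noteq> f"
  shows "{e, f} \<in> links L \<longleftrightarrow> \<not> (\<exists>A. dang A \<and> fe e \<in> A \<and> fe f \<in> A)"
  using not_liftable_iff[OF assms] liftable_sym[OF assms] assms
  by (auto simp: lifting_graph_def doubleton_eq_iff)

lemma independent_iff:
  "independent L F \<longleftrightarrow> F \<subseteq> S \<and>
    (\<forall>e\<in>F. \<forall>f\<in>F. e \<noteq> f \<longrightarrow> (\<exists>A. dang A \<and> fe e \<in> A \<and> fe f \<in> A))"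
proof -
  have 1: "pairs F \<inter> links L = {} \<longleftrightarrow> (\<forall>e\<in>F. \<forall>f\<in>F. e \<noteq> f \<longrightarrow> {e, f} \<notin> links L)"
    unfolding pairs_def by blast
  have 2: "{e, f} \<notin> links L \<longleftrightarrow> (\<exists>A. dang A \<and> fe e \<in> A \<and> fe f \<in> A)"
    if "F \<subseteq> S" "e \<in> F" "f \<in> F" "e \<noteq> f" for e f
    using pair_in_links_L_iff[of e f] that by blast
  show ?thesis unfolding independent_def nodes_L 1 using 2 by (intro conj_cong ball_cong imp_cong refl) simp
qed

lemma independent_dang:
  assumes "dang A"
  shows "independent L (cut_between G {s} A)"
  using assms in_cut_between_s_iff[OF G, of s A] dangD[OF assms] unfolding independent_iff by blast

lemma extend_independent:
  assumes "independent L F"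
  obtains F' where "maximal_independent L F'" "F \<subseteq> F'"
proof -
  have "{X. independent L X \<and> F \<subseteq> X} \<subseteq> Pow S" using independent_iff by auto
  then have "finite {X. independent L X \<and> F \<subseteq> X}" using fin_S finite_subset by blast
  then obtain M where "M \<in> {X. independent L X \<and> F \<subseteq> X}"
    "\<forall>X\<in>{X. independent L X \<and> F \<subseteq> X}. M \<subseteq> X \<longrightarrow> M = X"
    using finite_has_maximal[of "{X. independent L X \<and> F \<subseteq> X}"] assms by blast
  then have "maximal_independent L M" "F \<subseteq> M" unfolding maximal_independent_def by blast+
  then show thesis using that by blast
qed

text \<open>Two dangerous covers of \<open>F\<close> share two edges at \<open>s\<close>, hence are
  nested. So the minimal cover is unique and the definite description denotes it.\<close>

lemma dangerous_set_of_cover: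
  assumes "independent L F" "card F \<ge> 2"
  shows "dangerous_cover G s k F (dangerous_set_of G s k F)"
proof -
  have F: "F \<subseteq> S" using assms by (simp add: independent_iff)
  have "\<exists>A. dang A \<and> fe ` F \<subseteq> A" 
    using assms by (intro clique_dang[OF F]) (auto simp: independent_iff)
  then have ne: "{A. dangerous_cover G s k F A} \<noteq> {}" by (auto simp: dangerous_cover_def)
  have "{A. dangerous_cover G s k F A} \<subseteq> Pow (verts G)" using dangD by (auto simp: dangerous_cover_def)
  moreover have "finite (verts G)" using G by (simp add: multigraph_def)
  ultimately have "finite {A. dangerous_cover G s k F A}" using finite_subset by blast
  from finite_has_minimal[OF this ne] obtain A where A: "dangerous_cover G s k F A"
    "\<And>B. dangerous_cover G s k F B \<Longrightarrow> B \<subseteq> A \<Longrightarrow> B = A" by blast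
  obtain e f where ef: "e \<in> F" "f \<in> F" "e \<noteq> f"
    using two_elements[OF assms(2)] by blast
  have nested: "X \<subseteq> Y \<or> Y \<subseteq> X" if "dangerous_cover G s k F X" "dangerous_cover G s k F Y" for X Y
    using that ef F dang_nested[of X Y e f] unfolding dangerous_cover_def by blast
  have "dangerous_set_of G s k F = A"
    unfolding dangerous_set_of_def
  proof (rule the_equality)
    show "dangerous_cover G s k F A \<and> (\<forall>B. dangerous_cover G s k F B \<and> B \<subseteq> A \<longrightarrow> B = A)" using A by blast
    show "X = A" if "dangerous_cover G s k F X \<and> (\<forall>B. dangerous_cover G s k F B \<and> B \<subseteq> X \<longrightarrow> B = X)" for X
      using that A nested[of A X] by blast
  qed
  then show ?thesis using A by simp
qed

end

section \<open>Lines and their intersections\<close>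

locale connected_lifting_setting = lifting_setting +
  assumes conn_I: "sconnected (independence_graph L)"
begin

abbreviation "line F \<equiv> maximal_independent L F"
abbreviation "D F \<equiv> dangerous_set_of G s k F"
abbreviation "I \<equiv> independence_graph L"

lemma line_subset: "line F \<Longrightarrow> F \<subseteq> S"
  by (simp add: maximal_independent_def independent_iff)

lemma line_eq_if_subset: "line F \<Longrightarrow> line F' \<Longrightarrow> F \<subseteq> F' \<Longrightarrow> F = F'"
  unfolding maximal_independent_def by blast

lemma nodes_I: "nodes I = {F. line F}" by (simp add: independence_graph_def)

lemma links_I_iff: "{F, F'} \<in> links I \<longleftrightarrow> line F \<and> line F' \<and> F \<noteq> F' \<and> F \<inter> F' \<noteq> {}"
  by (auto simp: independence_graph_def doubleton_eq_iff)

lemma line_through: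
  assumes "e \<in> S"
  obtains F where "line F" "e \<in> F"
  using extend_independent[of "{e}"] assms by (auto simp: independent_iff)

text \<open>Some edge at \<open>s\<close> is outside a small \<open>F\<close>, so there is a second
  line, and connectedness gives a line \<open>X\<close> meeting \<open>F\<close>. Then
  \<open>F\<close> is a single edge contained in \<open>X\<close>, against maximality.\<close>

lemma card_line:
  assumes F: "line F"
  shows "card F \<ge> 2"
proof (rule ccontr)
  assume small: "\<not> ?thesis"
  have fin: "finite F" using line_subset[OF F] fin_S finite_subset by blast
  have "card S \<ge> 4" using deg4 by (simp add: deg_def)
  have "\<not> S \<subseteq> F" using small fin \<open>card S \<ge> 4\<close> card_mono[OF fin, of S] by auto
  then obtain f where f: "f \<in> S" "f \<notin> F" by blast
  obtain F' where F': "line F'" "f \<in> F'" using line_through f by blast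
  have "F \<in> nodes I" "F' \<in> nodes I" using F F' by (simp_all add: nodes_I)
  then have "\<exists>p. p \<noteq> [] \<and> distinct p \<and> set p \<subseteq> nodes I \<and> path_links p \<subseteq> links I \<and> hd p = F \<and> last p = F'"
    using conn_I[unfolded sconnected_def, THEN conjunct2, rule_format] by simp
  then obtain p where p: "p \<noteq> []" "path_links p \<subseteq> links I" "hd p = F" "last p = F'" by blast
  have "F \<noteq> F'" using f F' by blast
  then obtain X q where q: "p = F # X # q" using p(1,3,4) by (metis hd_Cons_tl last_ConsL list.sel(1))
  have "{F, X} \<in> path_links p" unfolding path_links_def q by force
  then have X: "line X" "F \<noteq> X" "F \<inter> X \<noteq> {}" using p(2) links_I_iff by blast+
  then obtain e where "e \<in> F" "e \<in> X" by blast
  then have "card F = 1" using small fin by (metis One_nat_def card_0_eq empty_iff less_2_cases not_le)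
  then have "F = {e}" using \<open>e \<in> F\<close> by (metis card_1_singletonE singletonD)
  then show False using line_eq_if_subset[OF F X(1)] X(2) \<open>e \<in> X\<close> by blast
qed

lemma D_dang: "line F \<Longrightarrow> dang (D F)"
  and D_cover: "line F \<Longrightarrow> e \<in> F \<Longrightarrow> fe e \<in> D F"
  using dangerous_set_of_cover[of F] card_line[of F]
  by (auto simp: maximal_independent_def dangerous_cover_def)

text \<open>The edges from \<open>s\<close> into a dangerous set form an independent set; here it
  contains the maximal set \<open>F\<close>.\<close>

lemma edges_into_D:
  assumes "line F"
  shows "cut_between G {s} (D F) = F"
proof -
  have s: "s \<notin> D F" using dangD[OF D_dang[OF assms]] by simp
  have "F \<subseteq> cut_between G {s} (D F)"
    using D_cover[OF assms] line_subset[OF assms] in_cut_between_s_iff[OF G s] by blast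
  moreover have "independent L (cut_between G {s} (D F))" using independent_dang D_dang assms by blast
  ultimately show ?thesis using assms unfolding maximal_independent_def by blast
qed

lemma in_D_iff: "line F \<Longrightarrow> e \<in> S \<Longrightarrow> fe e \<in> D F \<longleftrightarrow> e \<in> F"
  using edges_into_D[of F] in_cut_between_s_iff[OF G, of s "D F" e] dangD[OF D_dang[of F]] by blast

lemma D_subset_imp_eq:
  assumes "line F" "line F'" "D F \<subseteq> D F'"
  shows "F = F'"
proof -
  have "F \<subseteq> F'" using assms in_D_iff line_subset by (metis subsetD subsetI)
  then show ?thesis using line_eq_if_subset assms by blast
qed

text \<open>Two common edges make the dangerous sets nested, and nested sets belong to the same
  line.\<close>

lemma lines_meet:
  assumes "line F" "line F'" "F \<noteq> F'" "e \<in> F" "e \<in> F'" "f \<in> F" "f \<in> F'"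
  shows "e = f"
proof (rule ccontr)
  assume "e \<noteq> f"
  have "e \<in> S" "f \<in> S" using assms line_subset by blast+
  then have "D F \<subseteq> D F' \<or> D F' \<subseteq> D F"
    using dang_nested[of "D F" "D F'" e f] \<open>e \<noteq> f\<close> D_dang D_cover assms by blast
  then show False using D_subset_imp_eq assms by metis
qed

lemma line_other:
  assumes "line F"
  obtains f where "f \<in> F" "f \<noteq> e"
proof -
  have "finite F" using line_subset[OF assms] fin_S finite_subset by blast
  have "\<not> F \<subseteq> {e}" using card_line[OF assms] card_mono[of "{e}" F] by auto
  then show thesis using that by blast
qed

text \<open>Further edges of the three lines keep the three private parts nonempty, and
  \<open>fe e\<close> lies in the triple intersection. The three-set inequality would give
  \<open>4 * k + 2 \<le> 3 * k + 3\<close>, impossible for \<open>k \<ge> 2\<close>.\<close>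

lemma not_three_lines:
  assumes l: "line F1" "line F2" "line F3" and ne: "F1 \<noteq> F2" "F1 \<noteq> F3" "F2 \<noteq> F3"
    and e: "e \<in> F1" "e \<in> F2" "e \<in> F3"
  shows False
proof -
  let ?A = "D F1" and ?B = "D F2" and ?C = "D F3"
  have dd: "dang ?A" "dang ?B" "dang ?C" using l D_dang by blast+
  note sub = line_subset[OF l(1)] line_subset[OF l(2)] line_subset[OF l(3)]
  obtain a1 a2 a3 where a: "a1 \<in> F1" "a1 \<noteq> e" "a2 \<in> F2" "a2 \<noteq> e" "a3 \<in> F3" "a3 \<noteq> e"
    using line_other l by metis
  have out: "a1 \<notin> F2" "a1 \<notin> F3" "a2 \<notin> F1" "a2 \<notin> F3" "a3 \<notin> F1" "a3 \<notin> F2"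
    using lines_meet l ne e a by metis+
  have in1: "fe a1 \<in> ?A - ?B - ?C" "fe a2 \<in> ?B - ?A - ?C" "fe a3 \<in> ?C - ?A - ?B"
    using a out sub in_D_iff[OF l(1)] in_D_iff[OF l(2)] in_D_iff[OF l(3)] by blast+
  have in2: "fe e \<in> ?A \<inter> ?B \<inter> ?C" using e D_cover l by blast
  have ge: "k \<le> d (?A - ?B - ?C)" "k \<le> d (?B - ?A - ?C)" "k \<le> d (?C - ?A - ?B)" "k \<le> d (?A \<inter> ?B \<inter> ?C)"
    using in1 in2 dang_subset_ge[OF dd(1)] dang_subset_ge[OF dd(2)] dang_subset_ge[OF dd(3)]
    by (metis Diff_subset Int_lower1 empty_iff order_trans)+
  have s: "s \<notin> ?A \<union> ?B \<union> ?C" using dd dangD by blast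
  let ?Z = "?A \<inter> ?B \<union> ?A \<inter> ?C \<union> ?B \<inter> ?C"
  have "e \<in> cut_between G {s} ?Z"
    using in_cut_between_s_iff[OF G, of s ?Z] s in2 e sub by blast
  then have "1 \<le> b {s} ?Z" using finite_cut_between[OF G] by (metis One_nat_def Suc_leI card_gt_0_iff empty_iff)
  then show False
    using three_set_inequality[OF G s] ge dangD(6)[OF dd(1)] dangD(6)[OF dd(2)] dangD(6)[OF dd(3)] k2
    by linarith
qed

text \<open>\<open>crossing_diff_subset\<close> puts the part of \<open>D F\<close> outside
  \<open>D F1\<close> into \<open>D F2\<close>. Hence every edge of \<open>F\<close> is on
  \<open>F1\<close> or \<open>F2\<close>, each of which meets \<open>F\<close> only once.\<close>

lemma two_neighbours:
  assumes l: "line F" "line F1" "line F2" and ne: "F \<noteq> F1" "F \<noteq> F2" "F1 \<noteq> F2"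
    and e: "e \<in> F" "e \<in> F1" and f: "f \<in> F" "f \<in> F2"
  shows "e \<noteq> f" "F = {e, f}" "F1 \<inter> F2 = {}" "D F \<subseteq> D F1 \<union> D F2" "D F \<inter> D F1 \<inter> D F2 = {}"
    "odd k" "d (D F \<inter> D F1) = k"
proof -
  let ?A = "D F" and ?B = "D F1" and ?C = "D F2"
  have dd: "dang ?A" "dang ?B" "dang ?C" using l D_dang by blast+
  note sub = line_subset[OF l(1)] line_subset[OF l(2)] line_subset[OF l(3)]
  have eS: "e \<in> S" and fS: "f \<in> S" using e f sub by auto
  show ef: "e \<noteq> f" using not_three_lines[OF l ne] e f by blast
  have out: "e \<notin> F2" "f \<notin> F1" using lines_meet[OF l(1,2) ne(1) e] lines_meet[OF l(1,3) ne(2) f] e f ef by blast+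
  have n: "\<not> ?A \<subseteq> ?B" "\<not> ?B \<subseteq> ?A" "\<not> ?A \<subseteq> ?C" "\<not> ?C \<subseteq> ?A"
    using D_subset_imp_eq l ne by metis+
  have fe: "fe e \<in> ?A" "fe e \<in> ?B" "fe e \<notin> ?C" "fe f \<in> ?A" "fe f \<in> ?C" "fe f \<notin> ?B"
    using in_D_iff[OF l(1)] in_D_iff[OF l(2)] in_D_iff[OF l(3)] e f out eS fS by blast+
  have "?A - ?B \<subseteq> ?C"
    by (rule crossing_diff_subset[OF dd eS fe(1,2) n(1,2) fS fe(4,6,5) n(4)])
  then show sub3: "?A \<subseteq> ?B \<union> ?C" by blast
  show F: "F = {e, f}"
  proof
    show "{e, f} \<subseteq> F" using e f by blast
    show "F \<subseteq> {e, f}"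
    proof
      fix x assume x: "x \<in> F"
      then have "x \<in> F1 \<or> x \<in> F2" 
        using sub3 in_D_iff[OF l(1), of x] in_D_iff[OF l(2), of x] in_D_iff[OF l(3), of x] sub by blast
      then show "x \<in> {e, f}"
        using lines_meet[OF l(1,2) ne(1) e x] lines_meet[OF l(1,3) ne(2) f x] by blast
    qed
  qed
  show disj: "F1 \<inter> F2 = {}"
  proof (rule ccontr)
    assume "F1 \<inter> F2 \<noteq> {}"
    then obtain g where g: "g \<in> F1" "g \<in> F2" by blast
    then have "g \<notin> F" using not_three_lines[OF l ne] by blast
    \<comment> \<open>Each two of the three edges lie on a common line. A maximal extension shares
      \<open>e\<close> and \<open>f\<close> with \<open>F\<close>, so it would have to be
      \<open>F\<close>, which misses \<open>g\<close>.\<close>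
    have "independent L {e, f, g}"
    proof -
      have "\<exists>A. dang A \<and> fe x \<in> A \<and> fe y \<in> A" if "line X" "x \<in> X" "y \<in> X" for x y X
        using that D_dang D_cover by blast
      then have "\<exists>A. dang A \<and> fe e \<in> A \<and> fe f \<in> A" "\<exists>A. dang A \<and> fe e \<in> A \<and> fe g \<in> A"
        "\<exists>A. dang A \<and> fe f \<in> A \<and> fe g \<in> A" using l e f g by metis+
      then show ?thesis unfolding independent_iff using eS fS g sub by blast
    qed
    then obtain X where X: "line X" "{e, f, g} \<subseteq> X" using extend_independent by blast
    then have "X \<noteq> F" using \<open>g \<notin> F\<close> by blast
    then show False using lines_meet[OF X(1) l(1)] X e f ef by blast
  qed
  obtain a1 where a1: "a1 \<in> F1" "a1 \<noteq> e" using line_other[OF l(2)] by metis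
  obtain a2 where a2: "a2 \<in> F2" "a2 \<noteq> f" using line_other[OF l(3)] by metis
  have a: "a1 \<notin> F" "a1 \<notin> F2" "a2 \<notin> F" "a2 \<notin> F1" using F disj a1 a2 out by blast+
  \<comment> \<open>Here \<open>?A - ?B - ?C\<close> is empty, but both \<open>e\<close> and
    \<open>f\<close> enter pairwise intersections. The three-set inequality would read
    \<open>3 * k + 4 \<le> 3 * k + 3\<close>.\<close>
  show T: "?A \<inter> ?B \<inter> ?C = {}"
  proof (rule ccontr)
    assume ne: "?A \<inter> ?B \<inter> ?C \<noteq> {}"
    have "fe a1 \<in> ?B - ?A - ?C" "fe a2 \<in> ?C - ?A - ?B"
      using a a1 a2 sub in_D_iff[OF l(1)] in_D_iff[OF l(2)] in_D_iff[OF l(3)] by blast+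
    then have ge: "k \<le> d (?B - ?A - ?C)" "k \<le> d (?C - ?A - ?B)" "k \<le> d (?A \<inter> ?B \<inter> ?C)"
      using ne dang_subset_ge[OF dd(1)] dang_subset_ge[OF dd(2)] dang_subset_ge[OF dd(3)]
      by (metis Diff_subset Int_lower1 empty_iff order_trans)+
    have s: "s \<notin> ?A \<union> ?B \<union> ?C" using dd dangD by blast
    let ?Z = "?A \<inter> ?B \<union> ?A \<inter> ?C \<union> ?B \<inter> ?C"
    have "{e, f} \<subseteq> cut_between G {s} ?Z"
      using in_cut_between_s_iff[OF G, of s ?Z] s fe eS fS by blast
    then have "card {e, f} \<le> b {s} ?Z" using finite_cut_between[OF G] by (metis card_mono)
    then have "2 \<le> b {s} ?Z" using ef by simp
    then show False
      using three_set_inequality[OF G s] ge dangD(6)[OF dd(1)] dangD(6)[OF dd(2)] dangD(6)[OF dd(3)] k2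
      by linarith
  qed
  \<comment> \<open>The same set is a difference for the crossing at \<open>f\<close>, with cut size
    \<open>k\<close>, and an intersection for the crossing at \<open>e\<close>, with odd cut
    size.\<close>
  have "?A \<inter> ?B = ?A - ?C" using sub3 T by blast
  moreover have "d (?A - ?C) = k" by (rule crossing(3)[OF dd(1,3) fS fe(4,5) n(3,4) refl refl refl refl])
  ultimately show dP: "d (?A \<inter> ?B) = k" by simp
  have "d (?A \<inter> ?B) = 2 * b (?A \<inter> ?B) (?A - ?B) + 1"
    by (rule crossing(8)[OF dd(1,2) eS fe(1,2) n(1,2) refl refl refl refl])
  then have "k = 2 * b (?A \<inter> ?B) (?A - ?B) + 1" using dP by linarith
  then show "odd k" by (metis dvd_triv_left even_plus_one_iff)
qed

end

section \<open>Connected graphs of maximum degree two\<close>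

lemma path_links_Cons: "p \<noteq> [] \<Longrightarrow> path_links (x # p) = insert {x, hd p} (path_links p)"
proof (intro set_eqI iffI)
  fix l assume p: "p \<noteq> []"
  show "l \<in> insert {x, hd p} (path_links p)" if "l \<in> path_links (x # p)"
  proof -
    from that obtain i where "Suc i < length (x # p)" "l = {(x # p) ! i, (x # p) ! Suc i}"
      unfolding path_links_def by blast
    then show ?thesis using p by (cases i) (auto simp: path_links_def hd_conv_nth)
  qed
  show "l \<in> path_links (x # p)" if l: "l \<in> insert {x, hd p} (path_links p)"
  proof (cases "l = {x, hd p}")
    case True
    then show ?thesis using p unfolding path_links_def by (force simp: hd_conv_nth)
  next
    case False
    then obtain i where "Suc i < length p" "l = {p ! i, p ! Suc i}"
      using l unfolding path_links_def by blast
    then show ?thesis unfolding path_links_def by (intro CollectI exI[of _ "Suc i"]) auto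
  qed
qed

lemma path_links_rev_subset: "path_links p \<subseteq> path_links (rev p)"
proof
  fix l assume "l \<in> path_links p"
  then obtain i where i: "Suc i < length p" "l = {p ! i, p ! Suc i}" unfolding path_links_def by blast
  let ?j = "length p - Suc (Suc i)"
  have "Suc ?j < length (rev p)" "rev p ! ?j = p ! Suc i" "rev p ! Suc ?j = p ! i"
    using i by (auto simp: rev_nth Suc_diff_Suc)
  then show "l \<in> path_links (rev p)" unfolding path_links_def using i(2) by (metis (mono_tags, lifting) insert_commute mem_Collect_eq)
qed

lemma path_links_rev: "path_links (rev p) = path_links p"
  using path_links_rev_subset[of p] path_links_rev_subset[of "rev p"] by simp

lemma is_path_seq_rev: "is_path_seq H p \<Longrightarrow> is_path_seq H (rev p)"
  by (simp add: is_path_seq_def path_links_rev)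

lemma path_links_nth:
  assumes "distinct p" "i < j" "j < length p"
  shows "{p ! i, p ! j} \<in> path_links p \<longleftrightarrow> j = Suc i"
proof
  assume "{p ! i, p ! j} \<in> path_links p"
  then obtain t where t: "Suc t < length p" "{p ! i, p ! j} = {p ! t, p ! Suc t}"
    unfolding path_links_def by blast
  then have "i = t \<and> j = Suc t \<or> i = Suc t \<and> j = t"
    using assms by (auto simp: doubleton_eq_iff nth_eq_iff_index_eq)
  then show "j = Suc i" using assms by auto
next
  assume "j = Suc i"
  then show "{p ! i, p ! j} \<in> path_links p" using assms unfolding path_links_def by blast
qed

text \<open>A longest path is closed under neighbours: at an end a new neighbour would extend it,
  and inside it would be a third neighbour. By connectedness the path is then spanning.\<close>

theorem connected_max_degree_two:
  fixes H :: "'a sgraph"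
  assumes fin: "finite (nodes H)" and conn: "sconnected H"
    and simple: "\<And>l. l \<in> links H \<Longrightarrow> \<exists>x\<in>nodes H. \<exists>y\<in>nodes H. x \<noteq> y \<and> l = {x, y}"
    and deg: "\<And>x y1 y2 y3. {x, y1} \<in> links H \<Longrightarrow> {x, y2} \<in> links H \<Longrightarrow> {x, y3} \<in> links H \<Longrightarrow>
      y1 \<noteq> y2 \<Longrightarrow> y1 \<noteq> y3 \<Longrightarrow> y2 \<noteq> y3 \<Longrightarrow> False"
  shows "is_cycle H \<or> is_path H"
proof -
  define good where "good = (\<lambda>p. p \<noteq> [] \<and> distinct p \<and> set p \<subseteq> nodes H \<and> path_links p \<subseteq> links H)"
  obtain x0 where "x0 \<in> nodes H" using conn by (auto simp: sconnected_def)
  then have g0: "good [x0]" by (auto simp: good_def path_links_def)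
  have "length p < Suc (card (nodes H))" if "good p" for p
    using that fin unfolding good_def less_Suc_eq_le by (metis card_mono distinct_card)
  then obtain p where p: "good p" and max: "\<And>q. good q \<Longrightarrow> length q \<le> length p"
    using ex_has_greatest_nat[of good "[x0]" length "Suc (card (nodes H))"] g0 by blast
  have pp: "p \<noteq> []" "distinct p" "set p \<subseteq> nodes H" "path_links p \<subseteq> links H" using p by (auto simp: good_def)
  have step: "{p ! i, p ! Suc i} \<in> links H" if "Suc i < length p" for i
    using that pp(4) unfolding path_links_def by blast
  have closed: "y \<in> set p" if x: "x \<in> set p" and xy: "{x, y} \<in> links H" for x y
  proof (rule ccontr)
    assume y: "y \<notin> set p"
    have yn: "y \<in> nodes H" using simple[OF xy] by (auto simp: doubleton_eq_iff)
    obtain i where i: "i < length p" "x = p ! i" using x by (metis in_set_conv_nth)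
    consider "i = 0" | "Suc i = length p" | "0 < i" "Suc i < length p" using i by linarith
    then show False
    proof cases
      case 1
      then have "good (y # p)"
        using pp y yn xy i by (auto simp: good_def path_links_Cons hd_conv_nth insert_commute)
      then show False using max by fastforce
    next
      case 2
      then have "x = hd (rev p)" using i pp(1) by (metis diff_Suc_1 hd_rev last_conv_nth)
      then have "good (y # rev p)"
        using pp y yn xy by (auto simp: good_def path_links_Cons path_links_rev insert_commute)
      then show False using max by fastforce
    next
      case 3
      then have a: "{x, p ! (i - 1)} \<in> links H" "{x, p ! Suc i} \<in> links H"
        using step[of i] step[of "i - 1"] i by (simp_all add: insert_commute)
      have n: "p ! (i - 1) \<noteq> p ! Suc i" using pp(2) 3 by (auto simp: nth_eq_iff_index_eq)
      have "p ! (i - 1) \<noteq> y" "p ! Suc i \<noteq> y" using y 3 i(1) nth_mem by force+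
      then show False using deg[OF a xy n] by blast
    qed
  qed
  have "nodes H = set p"
  proof
    show "nodes H \<subseteq> set p"
    proof
      fix z assume z: "z \<in> nodes H"
      have hp: "hd p \<in> nodes H" using pp by auto
      obtain q where q: "q \<noteq> []" "path_links q \<subseteq> links H" "hd q = hd p" "last q = z"
        using conn[unfolded sconnected_def, THEN conjunct2, rule_format, OF hp z] by blast
      have "i < length q \<Longrightarrow> q ! i \<in> set p" for i
      proof (induction i)
        case 0
        then show ?case using q pp by (metis hd_conv_nth hd_in_set)
      next
        case (Suc i)
        then have "{q ! i, q ! Suc i} \<in> links H" using q(2) unfolding path_links_def by blast
        then show ?case using closed Suc by auto
      qed
      then show "z \<in> set p" using q by (metis diff_less last_conv_nth length_greater_0_conv zero_less_one)
    qed
  qed (use pp in simp)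
  have links: "links H \<subseteq> insert {last p, hd p} (path_links p)"
  proof
    fix l assume l: "l \<in> links H"
    \<comment> \<open>A link joining nonconsecutive positions would be a third one at any inner
      vertex, so it joins the two ends of the path.\<close>
    have "l \<in> insert {last p, hd p} (path_links p)"
      if l: "l = {p ! i, p ! j}" "l \<in> links H" and ij: "i < j" "j < length p" for i j
    proof (cases "j = Suc i")
      case True
      then show ?thesis using l ij unfolding path_links_def by blast
    next
      case False
      have "i = 0"
      proof (rule ccontr)
        assume "i \<noteq> 0"
        then have a: "{p ! i, p ! (i - 1)} \<in> links H" "{p ! i, p ! Suc i} \<in> links H"
          using step[of i] step[of "i - 1"] ij by (simp_all add: insert_commute)
        have "p ! (i - 1) \<noteq> p ! Suc i" "p ! (i - 1) \<noteq> p ! j" "p ! Suc i \<noteq> p ! j"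
          using pp(2) ij False by (auto simp: nth_eq_iff_index_eq)
        then show False using deg[OF a, of "p ! j"] l by blast
      qed
      moreover have "Suc j = length p"
      proof (rule ccontr)
        assume "Suc j \<noteq> length p"
        then have a: "{p ! j, p ! (j - 1)} \<in> links H" "{p ! j, p ! Suc j} \<in> links H"
          using step[of j] step[of "j - 1"] ij by (simp_all add: insert_commute)
        have b: "p ! (j - 1) \<noteq> p ! Suc j" "p ! (j - 1) \<noteq> p ! i" "p ! Suc j \<noteq> p ! i"
          using pp(2) ij False \<open>Suc j \<noteq> length p\<close> by (auto simp: nth_eq_iff_index_eq)
        have "{p ! j, p ! i} \<in> links H" using l by (simp add: insert_commute)
        then show False using deg[OF a] b by blast
      qed
      ultimately have "l = {last p, hd p}" using l pp(1) 
        by (metis diff_Suc_1 hd_conv_nth insert_commute last_conv_nth)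
      then show ?thesis by blast
    qed note wlog = this
    obtain x y where xy: "x \<in> nodes H" "y \<in> nodes H" "x \<noteq> y" "l = {x, y}" using simple[OF l] by blast
    then obtain i j where ij: "i < length p" "j < length p" "x = p ! i" "y = p ! j"
      using \<open>nodes H = set p\<close> by (metis in_set_conv_nth)
    then have "i < j \<or> j < i" using xy by (metis nat_neq_iff)
    then show "l \<in> insert {last p, hd p} (path_links p)"
      using wlog[of i j] wlog[of j i] ij xy l by (auto simp: insert_commute)
  qed
  show ?thesis
  proof (cases "links H = path_links p")
    case True
    then have "is_path_seq H p" using pp \<open>nodes H = set p\<close> by (simp add: is_path_seq_def)
    moreover have "length p = (length p - 1) + 1" using pp(1) by (cases p) auto
    ultimately show ?thesis unfolding is_path_def is_path_of_length_def by blast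
  next
    case False
    then have e: "{last p, hd p} \<in> links H" "{last p, hd p} \<notin> path_links p" using links pp(4) by blast+
    then have "links H = insert {last p, hd p} (path_links p)" using links pp(4) by blast
    \<comment> \<open>On shorter paths the closing link would be a loop or a link already on the
      path.\<close>
    moreover have "length p \<ge> 3"
    proof (rule ccontr)
      assume "\<not> ?thesis"
      moreover have "length p \<noteq> 0" using pp(1) by simp
      ultimately consider "length p = 1" | "length p = 2" by linarith
      then show False
      proof cases
        case 1
        then obtain x where "p = [x]" by (auto simp: length_Suc_conv)
        then show False using simple[OF e(1)] by auto
      next
        case 2
        then obtain x y where "p = [x, y]" by (auto simp: length_Suc_conv numeral_2_eq_2)
        then show False using e(2) by (auto simp: path_links_Cons insert_commute)
      qed
    qed
    ultimately have "is_cycle H" using pp(2) \<open>nodes H = set p\<close> unfolding is_cycle_def by blast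
    then show ?thesis ..
  qed
qed

section \<open>Adjacent lines\<close>

context connected_lifting_setting begin

lemma finite_nodes_I: "finite (nodes I)"
proof -
  have "nodes I \<subseteq> Pow S" using line_subset by (auto simp: nodes_I)
  then show ?thesis using fin_S finite_subset by blast
qed

lemma links_I_cases:
  assumes "l \<in> links I"
  obtains F F' where "l = {F, F'}" "line F" "line F'" "F \<noteq> F'" "F \<inter> F' \<noteq> {}"
  using assms unfolding independence_graph_def by auto

text \<open>Two neighbours force \<open>F = {e1, e2}\<close>, so a third neighbour would pass
  through \<open>e1\<close> or \<open>e2\<close> and create three lines through one edge.\<close>

lemma cycle_or_path: "is_cycle I \<or> is_path I"
proof (rule connected_max_degree_two[OF finite_nodes_I conn_I])
  show "\<exists>x\<in>nodes I. \<exists>y\<in>nodes I. x \<noteq> y \<and> l = {x, y}" if "l \<in> links I" for l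
    using links_I_cases[OF that] unfolding nodes_I by (metis mem_Collect_eq)
next
  fix F F1 F2 F3
  assume "{F, F1} \<in> links I" "{F, F2} \<in> links I" "{F, F3} \<in> links I"
    and ne: "F1 \<noteq> F2" "F1 \<noteq> F3" "F2 \<noteq> F3"
  then have l: "line F" "line F1" "line F2" "line F3" "F \<noteq> F1" "F \<noteq> F2" "F \<noteq> F3"
    and "F \<inter> F1 \<noteq> {}" "F \<inter> F2 \<noteq> {}" "F \<inter> F3 \<noteq> {}" unfolding links_I_iff by blast+
  then obtain e1 e2 e3 where e: "e1 \<in> F" "e1 \<in> F1" "e2 \<in> F" "e2 \<in> F2" "e3 \<in> F" "e3 \<in> F3" by blast
  have "F = {e1, e2}" using two_neighbours(2)[OF l(1,2,3,5,6) ne(1) e(1-4)] .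
  then have "e3 = e1 \<or> e3 = e2" using e by blast
  then show False
    using not_three_lines[OF l(1,2,4,5,7) ne(2)] not_three_lines[OF l(1,3,4,6,7) ne(3)] e by blast
qed

lemma card_line_degree_two:
  assumes F: "line F" and deg: "sdegree I F = 2"
  shows "card F = 2"
proof -
  have "2 \<le> card {l \<in> links I. F \<in> l}" using deg by (simp add: sdegree_def)
  then obtain l1 l2 where l: "l1 \<in> links I" "F \<in> l1" "l2 \<in> links I" "F \<in> l2" "l1 \<noteq> l2"
    using two_elements by blast
  obtain F1 where F1: "l1 = {F, F1}" using links_I_cases[OF l(1)] l(2) by (metis insertE insert_commute singletonD)
  obtain F2 where F2: "l2 = {F, F2}" using links_I_cases[OF l(3)] l(4) by (metis insertE insert_commute singletonD)
  have ll: "line F1" "line F2" "F \<noteq> F1" "F \<noteq> F2" "F1 \<noteq> F2" "F \<inter> F1 \<noteq> {}" "F \<inter> F2 \<noteq> {}"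
    using l links_I_iff unfolding F1 F2 by blast+
  then obtain e f where ef: "e \<in> F" "e \<in> F1" "f \<in> F" "f \<in> F2" by blast
  show ?thesis using two_neighbours(1,2)[OF F ll(1,2,3,4,5) ef] by simp
qed

lemma nodes_complement_L: "nodes (complement L) = S"
  by (simp add: complement_def nodes_L)

text \<open>A pair that is not liftable is independent, so it extends to a line; conversely the
  dangerous set of a line covers each of its pairs.\<close>

lemma links_complement_L: "links (complement L) = \<Union> (pairs ` {F. line F})"
proof -
  have "{e, f} \<notin> links L \<longleftrightarrow> (\<exists>F. line F \<and> e \<in> F \<and> f \<in> F)" if ef: "e \<in> S" "f \<in> S" "e \<noteq> f" for e f
  proof
    assume "{e, f} \<notin> links L"
    then obtain A where "dang A" "fe e \<in> A" "fe f \<in> A" using pair_in_links_L_iff[OF ef] by blast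
    then have "independent L {e, f}" unfolding independent_iff using ef by blast
    then show "\<exists>F. line F \<and> e \<in> F \<and> f \<in> F" using extend_independent by (metis insert_subset)
  next
    assume "\<exists>F. line F \<and> e \<in> F \<and> f \<in> F"
    then show "{e, f} \<notin> links L" using pair_in_links_L_iff[OF ef] D_dang D_cover by blast
  qed
  note * = this
  show ?thesis
  proof (intro set_eqI iffI)
    fix l assume "l \<in> links (complement L)"
    then obtain e f where ef: "l = {e, f}" "e \<in> S" "f \<in> S" "e \<noteq> f" "{e, f} \<notin> links L"
      unfolding complement_def nodes_L pairs_def by auto
    then obtain F where "line F" "e \<in> F" "f \<in> F" using * by blast
    then show "l \<in> \<Union> (pairs ` {F. line F})" using ef unfolding pairs_def by blast
  next
    fix l assume "l \<in> \<Union> (pairs ` {F. line F})"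
    then obtain F e f where F: "line F" "e \<in> F" "f \<in> F" "e \<noteq> f" "l = {e, f}" unfolding pairs_def by blast
    have S: "e \<in> S" "f \<in> S" using F line_subset by blast+
    have "l \<notin> links L" using * S F by blast
    moreover have "l \<in> pairs S" unfolding pairs_def using F S by blast
    ultimately show "l \<in> links (complement L)" unfolding complement_def nodes_L by simp
  qed
qed

lemma Union_lines: "\<Union> {F. line F} = S"
proof
  show "\<Union> {F. line F} \<subseteq> S" using line_subset by blast
  show "S \<subseteq> \<Union> {F. line F}"
  proof
    fix e assume "e \<in> S"
    then show "e \<in> \<Union> {F. line F}" using line_through by blast
  qed
qed

lemma adjacent_crossing:
  assumes l: "line F" "line F1" "F \<noteq> F1" and e: "e \<in> F" "e \<in> F1"
  shows "d (D F - D F1) = k"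
    and "cut_between G (D F \<inter> D F1) (verts G - (D F \<union> D F1)) = {e}"
    and "b (D F \<inter> D F1) (D F1 - D F) = b (D F \<inter> D F1) (D F - D F1)"
    and "b (D F1 - D F) (verts G - (D F \<union> D F1)) = b (D F - D F1) (verts G - (D F \<union> D F1))"
    and "d (D F \<inter> D F1) = 2 * b (D F \<inter> D F1) (D F - D F1) + 1"
    and "d (D F \<union> D F1) = 2 * b (D F - D F1) (verts G - (D F \<union> D F1)) + 1"
    and "b (D F \<inter> D F1) (D F - D F1) + b (D F - D F1) (D F1 - D F) +
      b (D F - D F1) (verts G - (D F \<union> D F1)) = k"
    and "k \<le> d (D F \<inter> D F1)"
proof -
  have eS: "e \<in> S" using e line_subset l by blast
  have n: "\<not> D F \<subseteq> D F1" "\<not> D F1 \<subseteq> D F" using D_subset_imp_eq l by metis+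
  note c = crossing[OF D_dang[OF l(1)] D_dang[OF l(2)] eS D_cover[OF l(1) e(1)] D_cover[OF l(2) e(2)] n
      refl refl refl refl]
  show "d (D F - D F1) = k"
    and "cut_between G (D F \<inter> D F1) (verts G - (D F \<union> D F1)) = {e}"
    and "b (D F \<inter> D F1) (D F1 - D F) = b (D F \<inter> D F1) (D F - D F1)"
    and "b (D F1 - D F) (verts G - (D F \<union> D F1)) = b (D F - D F1) (verts G - (D F \<union> D F1))"
    and "d (D F \<inter> D F1) = 2 * b (D F \<inter> D F1) (D F - D F1) + 1"
    and "d (D F \<union> D F1) = 2 * b (D F - D F1) (verts G - (D F \<union> D F1)) + 1"
    and "b (D F \<inter> D F1) (D F - D F1) + b (D F - D F1) (D F1 - D F) +
      b (D F - D F1) (verts G - (D F \<union> D F1)) = k"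
    and "k \<le> d (D F \<inter> D F1)"
    by (fact c)+
qed

text \<open>The only edge from the intersection to the outside of the union is the shared edge
  \<open>e\<close>, whose other end is \<open>s\<close>.\<close>

lemma edge_at_intersection:
  assumes l: "line F" "line F1" "F \<noteq> F1" "F \<inter> F1 \<noteq> {}"
    and h: "h \<in> edges G" "ends G h = {x, y}" "x \<in> D F" "x \<in> D F1" "y \<noteq> s"
  shows "y \<in> D F \<union> D F1"
proof (rule ccontr)
  assume y: "y \<notin> D F \<union> D F1"
  obtain e where e: "e \<in> F" "e \<in> F1" using l by blast
  have "y \<in> verts G" using h G unfolding multigraph_def by auto
  then have "h \<in> cut_between G (D F \<inter> D F1) (verts G - (D F \<union> D F1))"
    unfolding in_cut_between_iff[OF h(1,2)] using h y by blast
  then have "h = e" using adjacent_crossing(2)[OF l(1-3) e] by blast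
  then have "ends G h = {s, fe e}" using ends_incident_edge(1)[OF G] e line_subset[OF l(1)] by blast
  then have "x = s" using h by (auto simp: doubleton_eq_iff)
  then show False using h(3) dangD(2)[OF D_dang[OF l(1)]] by blast
qed

section \<open>Tight pairs and the blocks they define\<close>

text \<open>Adjacent lines are tight as soon as one of them has a second neighbour.\<close>

definition tight :: "'b set \<Rightarrow> 'b set \<Rightarrow> bool" where
  "tight F F1 \<longleftrightarrow> line F \<and> line F1 \<and> F \<noteq> F1 \<and> F \<inter> F1 \<noteq> {} \<and> d (D F \<inter> D F1) = k \<and> odd k"

lemma tight_sym: "tight F F1 \<Longrightarrow> tight F1 F"
  unfolding tight_def by (auto simp: Int_commute)

text \<open>If the sets crossed, then \<open>X \<inter> Y\<close> would send \<open>k / 2\<close> edges to each of the two differences.\<close>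

lemma tight_disjoint:
  assumes X: "X \<subseteq> verts G - {s}" "d X = k" and Y: "Y \<subseteq> verts G - {s}" "d Y = k" and "odd k"
    and n: "\<not> X \<subseteq> Y" "\<not> Y \<subseteq> X" and un: "X \<union> Y \<noteq> verts G - {s}"
  shows "X \<inter> Y = {}"
proof (rule ccontr)
  assume ne: "X \<inter> Y \<noteq> {}"
  have "X \<subseteq> verts G" "Y \<subseteq> verts G" using X Y by auto
  note c = card_cut_cells[OF G this refl refl refl refl refl]
  have "k \<le> d (X - Y)" "k \<le> d (Y - X)" "k \<le> d (X \<inter> Y)" "k \<le> d (X \<union> Y)"
    using X Y n un ne by (intro cut_ge; blast)+
  then have "k = 2 * b (X \<inter> Y) (X - Y)" using c X(2) Y(2) by linarith
  then show False using \<open>odd k\<close> by (metis dvd_triv_left)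
qed

text \<open>A tight pair splits \<open>D F\<close> into two blocks of cut size \<open>k\<close>. The
  two existence claims provide the witnesses needed to apply \<open>tight_disjoint\<close> to blocks
  of different lines.\<close>

lemma tight_part:
  assumes t: "tight F F1" and X: "X = D F \<inter> D F1 \<or> X = D F - D F1"
  shows "d X = k" "X \<subseteq> D F" "\<exists>a\<in>F. fe a \<in> X" "\<exists>a\<in>F. fe a \<notin> X"
proof -
  have l: "line F" "line F1" "F \<noteq> F1" "F \<inter> F1 \<noteq> {}" "d (D F \<inter> D F1) = k" using t by (auto simp: tight_def)
  obtain e where e: "e \<in> F" "e \<in> F1" using l by blast
  obtain a where a: "a \<in> F" "a \<noteq> e" using line_other[OF l(1)] by metis
  have "a \<notin> F1" using lines_meet[OF l(1-3) e a(1)] a(2) by blast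
  moreover have "a \<in> S" using a line_subset l by blast
  ultimately have "fe a \<in> D F" "fe a \<notin> D F1" using in_D_iff l a by blast+
  moreover have "fe e \<in> D F" "fe e \<in> D F1" using D_cover l e by blast+
  ultimately show "\<exists>a\<in>F. fe a \<in> X" "\<exists>a\<in>F. fe a \<notin> X" using X e(1) a(1) by blast+
  show "d X = k" "X \<subseteq> D F" using X l(5) adjacent_crossing(1)[OF l(1-3) e] by blast+
qed

text \<open>Each block contains a far end of its own line, which the other set misses, so blocks of
  \<open>F\<close> and \<open>F'\<close> are incomparable. Some far end of \<open>F\<close> lies
  outside both blocks, so their union is proper. Hence all four pairs of blocks are
  disjoint.\<close>

lemma tight_D_disjoint:
  assumes t: "tight F F1" and t': "tight F' F1'" and disj: "F \<inter> F' = {}"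
  shows "D F \<inter> D F' = {}"
proof -
  have l: "line F" "line F'" "odd k" using t t' by (auto simp: tight_def)
  have "X \<inter> Y = {}" if X: "X = D F \<inter> D F1 \<or> X = D F - D F1" and Y: "Y = D F' \<inter> D F1' \<or> Y = D F' - D F1'" for X Y
  proof -
    note x = tight_part[OF t X] and y = tight_part[OF t' Y]
    have vs: "D F \<subseteq> verts G - {s}" "D F' \<subseteq> verts G - {s}" using dangD(1,2) D_dang l by blast+
    have FS: "F \<subseteq> S" "F' \<subseteq> S" using line_subset l by blast+
    have out: "fe a \<notin> Y" if "a \<in> F" for a using in_D_iff[OF l(2), of a] y(2) that disj FS by blast
    have out': "fe a \<notin> X" if "a \<in> F'" for a using in_D_iff[OF l(1), of a] x(2) that disj FS by blast
    obtain a where a: "a \<in> F" "fe a \<notin> X" using x(4) by blast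
    have "fe a \<in> verts G - {s}" using fe_verts FS a by blast
    then have un: "X \<union> Y \<noteq> verts G - {s}" using a out by blast
    show ?thesis
      by (rule tight_disjoint[OF _ x(1) _ y(1) l(3)]) (use x y vs out out' un in blast)+
  qed
  note parts = this
  have "(D F \<inter> D F1) \<inter> (D F' \<inter> D F1') = {}" "(D F \<inter> D F1) \<inter> (D F' - D F1') = {}"
    "(D F - D F1) \<inter> (D F' \<inter> D F1') = {}" "(D F - D F1) \<inter> (D F' - D F1') = {}"
    by (rule parts; simp)+
  then show ?thesis by blast
qed

lemma two_neighbours_tight:
  assumes l: "line F" "line F1" "line F2" and ne: "F \<noteq> F1" "F \<noteq> F2" "F1 \<noteq> F2"
    and "F \<inter> F1 \<noteq> {}" "F \<inter> F2 \<noteq> {}"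
  shows "tight F F1" "tight F F2"
proof -
  obtain e f where ef: "e \<in> F" "e \<in> F1" "f \<in> F" "f \<in> F2" using assms by blast
  show "tight F F1" "tight F F2"
    using two_neighbours(6,7)[OF l ne ef] two_neighbours(7)[OF l(1,3,2) ne(2,1) ne(3)[symmetric] ef(3,4,1,2)] assms
    by (simp_all add: tight_def)
qed

text \<open>All edges of \<open>F\<close> except the shared one end in the difference. The second
  count is the crossing identity \<open>d P = 2 * b P Q + 1\<close> with
  \<open>d P = k\<close>.\<close>

lemma tight_end_counts:
  assumes t: "tight F F1"
  shows "b (D F - D F1) {s} + 1 = card F" "2 * b (D F - D F1) (D F \<inter> D F1) + 1 = k"
proof -
  have l: "line F" "line F1" "F \<noteq> F1" "F \<inter> F1 \<noteq> {}" "d (D F \<inter> D F1) = k" using t by (auto simp: tight_def)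
  obtain e where e: "e \<in> F" "e \<in> F1" using l by blast
  have s: "s \<notin> D F" using dangD(2) D_dang l by blast
  have "x \<in> cut_between G {s} (D F - D F1) \<longleftrightarrow> x \<in> F - {e}" for x
    using in_cut_between_s_iff[OF G, of s "D F - D F1" x] s in_D_iff[OF l(1), of x] in_D_iff[OF l(2), of x]
      lines_meet[OF l(1-3) e, of x] e line_subset[OF l(1)] by blast
  then have "cut_between G {s} (D F - D F1) = F - {e}" by blast
  moreover have "finite F" using line_subset[OF l(1)] fin_S finite_subset by blast
  ultimately show "b (D F - D F1) {s} + 1 = card F"
    using e by (metis Suc_eq_plus1 card_Suc_Diff1 cut_between_commute)
  show "2 * b (D F - D F1) (D F \<inter> D F1) + 1 = k"
    using adjacent_crossing(5)[OF l(1-3) e] l(5) cut_between_commute[of G "D F - D F1" "D F \<inter> D F1"] by simp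
qed

text \<open>The \<open>k\<close> edges leaving the block are sorted by their other ends. The target
  \<open>Z\<close> is left open: it will be the uncovered set, and later the opposite end
  block.\<close>

lemma end_part_degree:
  assumes t: "tight F F1" and Z: "Z \<subseteq> verts G - {s} - D F"
  shows "k = b (D F - D F1) (D F \<inter> D F1) + b (D F - D F1) {s} + b (D F - D F1) Z
    + b (D F - D F1) (verts G - {s} - D F - Z)"
proof -
  have l: "line F" "line F1" using t by (auto simp: tight_def)
  have A: "D F \<subseteq> verts G" "s \<notin> D F" using dangD(1,2) D_dang l by blast+
  let ?Q = "D F - D F1" and ?P = "D F \<inter> D F1" and ?R = "verts G - {s} - D F - Z"
  have "verts G - ?Q = ?P \<union> ({s} \<union> (Z \<union> ?R))" using A Z s_in by auto
  then have "d ?Q = b ?Q (?P \<union> ({s} \<union> (Z \<union> ?R)))" by (simp add: cut_eq_cut_between[OF G])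
  also have "\<dots> = b ?Q ?P + b ?Q ({s} \<union> (Z \<union> ?R))"
    by (rule card_cut_between_Un(2)[OF G]) (use A Z in auto)
  also have "b ?Q ({s} \<union> (Z \<union> ?R)) = b ?Q {s} + b ?Q (Z \<union> ?R)"
    by (rule card_cut_between_Un(2)[OF G]) (use A Z in auto)
  also have "b ?Q (Z \<union> ?R) = b ?Q Z + b ?Q ?R"
    by (rule card_cut_between_Un(2)[OF G]) (use A Z in auto)
  finally show ?thesis using tight_part(1)[OF t, of ?Q] by simp
qed

section \<open>Vertices outside all dangerous sets of lines\<close>

abbreviation "uncovered \<equiv> verts G - {s} - (\<Union>F\<in>{F. line F}. D F)"

lemma uncovered_ge:
  assumes "uncovered \<noteq> {}"
  shows "k \<le> d uncovered"
proof -
  have "S \<noteq> {}" using deg4 by (auto simp: deg_def)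
  then obtain e where e: "e \<in> S" by blast
  then obtain F where "line F" "e \<in> F" using line_through by blast
  then have "fe e \<notin> uncovered" "fe e \<in> verts G - {s}" using D_cover fe_verts e by blast+
  then show ?thesis using assms by (intro cut_ge) blast+
qed

text \<open>The end \<open>y\<close> is not \<open>s\<close>, because every edge at \<open>s\<close>
  is on a line, whose dangerous set contains its far end. The last property holds since edges at an
  intersection stay within the union or go to \<open>s\<close>.\<close>

lemma uncovered_edge:
  assumes "h \<in> cut G uncovered"
  obtains x y F where "h \<in> edges G" "ends G h = {x, y}" "x \<in> uncovered" "line F" "y \<in> D F"
    "\<And>F1 F2. line F1 \<Longrightarrow> line F2 \<Longrightarrow> F1 \<noteq> F2 \<Longrightarrow> F1 \<inter> F2 \<noteq> {} \<Longrightarrow> y \<in> D F1 \<Longrightarrow> y \<notin> D F2"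
proof -
  obtain x y where h: "ends G h = {x, y}" "x \<in> uncovered" "y \<notin> uncovered" "y \<in> verts G" "h \<in> edges G"
    using cut_edge_obtain[OF G assms] by metis
  have "y \<noteq> s"
  proof
    assume "y = s"
    then have "h \<in> S" "fe h = x"
    proof -
      have "x \<noteq> s" using h by blast
      then show hS: "h \<in> S" using in_cut_iff[OF G h(5,1)] \<open>y = s\<close> by blast
      show "fe h = x" using ends_incident_edge(1,2)[OF G hS] h(1) \<open>y = s\<close> \<open>x \<noteq> s\<close> by (auto simp: doubleton_eq_iff)
    qed
    moreover obtain F where "line F" "h \<in> F" using line_through calculation by blast
    ultimately show False using D_cover h(2) by blast
  qed
  then obtain F where F: "line F" "y \<in> D F" using h by blast
  have other: "y \<notin> D F2" if F12: "line F1" "line F2" "F1 \<noteq> F2" "F1 \<inter> F2 \<noteq> {}" and y: "y \<in> D F1" for F1 F2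
  proof
    assume y2: "y \<in> D F2"
    have "x \<in> D F1 \<union> D F2"
      by (rule edge_at_intersection[OF F12 h(5) _ y y2]) (use h in auto)
    then show False using h(2) F12 by blast
  qed
  show thesis by (rule that[OF h(5,1,2) F other])
qed

end

section \<open>Independence graphs that are paths\<close>

lemma pairs_doubleton:
  assumes "x \<noteq> y"
  shows "pairs {x, y} = {{x, y}}"
proof
  show "pairs {x, y} \<subseteq> {{x, y}}" by (auto simp: pairs_def insert_commute)
  have "{x, y} \<in> pairs {x, y}" unfolding pairs_def using assms by blast
  then show "{{x, y}} \<subseteq> pairs {x, y}" by simp
qed

context connected_lifting_setting begin

text \<open>A single line would contain all edges at \<open>s\<close>, but a dangerous set always
  misses one of their far ends.\<close>

lemma path_seq_length:
  assumes "is_path_seq I Is"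
  shows "length Is \<ge> 2"
proof (rule ccontr)
  assume "\<not> ?thesis"
  moreover have "length Is \<noteq> 0" using assms by (simp add: is_path_seq_def)
  ultimately have "length Is = Suc 0" by linarith
  then obtain F where "Is = [F]" by (auto simp: length_Suc_conv)
  then have F: "{F. line F} = {F}" using assms by (auto simp: is_path_seq_def nodes_I)
  then have l: "line F" by blast
  obtain e where e: "e \<in> S" "fe e \<notin> D F" using dang_misses_edge[OF D_dang[OF l]] by blast
  obtain F' where "line F'" "e \<in> F'" using line_through[OF e(1)] by blast
  then have "e \<in> F" using F by blast
  then show False using D_cover[OF l] e(2) by blast
qed

text \<open>Once coverage is known, the outside of the two dangerous sets is just
  \<open>{s}\<close>, and the crossing equalities become statements about the sizes of the
  lines.\<close>

lemma two_lines:
  assumes lines: "{F. line F} = {F1, F2}" and ne: "F1 \<noteq> F2" and e: "e \<in> F1" "e \<in> F2"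
  shows "uncovered = {}" "F1 \<union> F2 = S" "F1 \<inter> F2 = {e}" "card F1 = card F2"
    "card F1 + card F2 = deg G s + 1" "2 * card F1 \<le> k + 3"
proof -
  have l: "line F1" "line F2" using lines by blast+
  show un: "F1 \<union> F2 = S" using Union_lines lines by simp
  show meet: "F1 \<inter> F2 = {e}" using lines_meet[OF l ne] e by blast
  let ?A = "D F1" and ?B = "D F2"
  let ?W = "verts G - (?A \<union> ?B)"
  note c = adjacent_crossing[OF l ne e]
  have A: "?A \<subseteq> verts G - {s}" "?B \<subseteq> verts G - {s}" using dangD(1,2) D_dang l by blast+
  have all: "fe h \<in> ?A \<union> ?B" if "h \<in> S" for h using that un D_cover l by blast
  have unc: "uncovered = ?W - {s}" using lines by auto
  have sAB: "cut_between G {s} (?A \<union> ?B) = S"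
    using all in_cut_between_s_iff[OF G, of s "?A \<union> ?B"] A by blast
  show empty: "uncovered = {}"
  proof (rule ccontr)
    assume U: "uncovered \<noteq> {}"
    then have kU: "k \<le> d uncovered" by (rule uncovered_ge)
    have AB: "?A \<union> ?B \<subseteq> verts G - {s}" "?A \<union> ?B \<noteq> verts G - {s}" "?A \<union> ?B \<noteq> {}"
      using A U unc dangD(3)[OF D_dang[OF l(1)]] by blast+
    have "\<not> dang (?A \<union> ?B)" using dang_misses_edge all by blast
    then have "k + 2 \<le> d (?A \<union> ?B)" using AB unfolding dangerous_def by auto
    \<comment> \<open>For the upper bound, \<open>d (?A \<union> ?B)\<close> is one more than twice
      the number of edges from \<open>?A - ?B\<close> to the outside. That number is at most
      \<open>k\<close> minus those to the intersection, which are at least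
      \<open>(k - 1) / 2\<close>.\<close>
    then have dAB: "d (?A \<union> ?B) = k + 2" using c(5-8) by linarith
    have W: "?W = {s} \<union> uncovered" using unc A s_in by blast
    have "d (?A \<union> ?B) = b (?A \<union> ?B) ({s} \<union> uncovered)"
      unfolding cut_eq_cut_between[OF G, of "?A \<union> ?B"] W ..
    also have "\<dots> = b (?A \<union> ?B) {s} + b (?A \<union> ?B) uncovered"
      by (rule card_cut_between_Un(2)[OF G]) (use A unc in auto)
    finally have 1: "k + 2 = deg G s + b (?A \<union> ?B) uncovered"
      using dAB sAB by (simp add: deg_def cut_between_commute[of G _ "{s}"])
    \<comment> \<open>All edges leaving the uncovered set end in \<open>?A \<union> ?B\<close>, so
      there are at most \<open>k + 2 - deg G s\<close>, which is less than \<open>k\<close>.\<close>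
    have "cut G uncovered \<subseteq> cut_between G (?A \<union> ?B) uncovered"
    proof
      fix h assume "h \<in> cut G uncovered"
      then obtain x y F where h: "h \<in> edges G" "ends G h = {x, y}" and x: "x \<in> uncovered"
        and F: "line F" "y \<in> D F"
        using uncovered_edge by metis
      have "F = F1 \<or> F = F2" using lines F(1) by blast
      then have "y \<in> ?A \<union> ?B" using F(2) by blast
      then show "h \<in> cut_between G (?A \<union> ?B) uncovered" unfolding in_cut_between_iff[OF h] using x by simp
    qed
    then have "d uncovered \<le> b (?A \<union> ?B) uncovered" by (intro card_mono finite_cut_between[OF G])
    then show False using 1 kU deg4 by linarith
  qed
  then have W: "?W = {s}" using unc A s_in by blast
  have fin: "finite F1" "finite F2" using line_subset l fin_S finite_subset by blast+
  have "x \<in> cut_between G {s} (?A - ?B) \<longleftrightarrow> x \<in> F1 - {e}"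
    "x \<in> cut_between G {s} (?B - ?A) \<longleftrightarrow> x \<in> F2 - {e}" for x
  proof -
    have s: "s \<notin> ?A - ?B" "s \<notin> ?B - ?A" using A by blast+
    have "x \<in> F1 \<and> x \<in> F2 \<longleftrightarrow> x = e" using meet by blast
    moreover have "x \<in> F1 \<longrightarrow> x \<in> S" "x \<in> F2 \<longrightarrow> x \<in> S" using line_subset l by blast+
    ultimately show "x \<in> cut_between G {s} (?A - ?B) \<longleftrightarrow> x \<in> F1 - {e}"
      "x \<in> cut_between G {s} (?B - ?A) \<longleftrightarrow> x \<in> F2 - {e}"
      unfolding in_cut_between_s_iff[OF G s(1)] in_cut_between_s_iff[OF G s(2)]
      using in_D_iff[OF l(1), of x] in_D_iff[OF l(2), of x] by auto
  qed
  then have "cut_between G {s} (?A - ?B) = F1 - {e}" "cut_between G {s} (?B - ?A) = F2 - {e}" by blast+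
  then have q: "b (?A - ?B) {s} + 1 = card F1" "b (?B - ?A) {s} + 1 = card F2"
    using e fin by (metis Suc_eq_plus1 card_Suc_Diff1 cut_between_commute)+
  then show "card F1 = card F2" using c(4) W by simp
  have "card F1 + card F2 = card S + 1" using card_Un_Int[OF fin] un meet by simp
  then show "card F1 + card F2 = deg G s + 1" by (simp add: deg_def)
  \<comment> \<open>Of the \<open>k\<close> edges leaving \<open>?A - ?B\<close>, at least
    \<open>(k - 1) / 2\<close> go to the intersection, so at most \<open>(k + 1) / 2\<close> go to
    \<open>s\<close>; adding \<open>e\<close> gives the bound.\<close>
  show "2 * card F1 \<le> k + 3" using q c(5,7,8) W by simp
qed

end

section \<open>Paths with at least three lines, indexed from 0\<close>

locale long_path_setting = connected_lifting_setting +
  fixes Is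
  assumes path: "is_path_seq I Is" and len: "length Is \<ge> 3"
begin

abbreviation "m \<equiv> length Is"
abbreviation "A i \<equiv> D (Is ! i)"

lemma line_nth: "i < m \<Longrightarrow> line (Is ! i)"
  using path nth_mem[of i Is] unfolding is_path_seq_def nodes_I by blast

lemma line_index: "line F \<Longrightarrow> \<exists>i<m. F = Is ! i"
  using path unfolding is_path_seq_def nodes_I by (metis in_set_conv_nth mem_Collect_eq)

lemma nth_lines_neq: "i < m \<Longrightarrow> j < m \<Longrightarrow> i \<noteq> j \<Longrightarrow> Is ! i \<noteq> Is ! j"
  using path by (simp add: is_path_seq_def nth_eq_iff_index_eq)

lemma nth_lines_meet_iff: "j < m \<Longrightarrow> i < j \<Longrightarrow> Is ! i \<inter> Is ! j \<noteq> {} \<longleftrightarrow> j = Suc i"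
  using path_links_nth[of Is i j] links_I_iff[of "Is ! i" "Is ! j"] line_nth[of i] line_nth[of j] nth_lines_neq[of i j] path
  by (simp add: is_path_seq_def)

lemma consecutive_lines_meet: "Suc i < m \<Longrightarrow> Is ! i \<inter> Is ! Suc i \<noteq> {}" using nth_lines_meet_iff[of "Suc i" i] by simp

lemma nonconsecutive_lines_disjoint: "j < m \<Longrightarrow> Suc i < j \<Longrightarrow> Is ! i \<inter> Is ! j = {}" using nth_lines_meet_iff[of j i] by auto

lemma length_bounds: "0 < m" "1 < m" "m - 1 < m" "m - 2 < m" using len by linarith+

lemma D_nth_subset: "i < m \<Longrightarrow> A i \<subseteq> verts G - {s}" using dangD(1,2)[OF D_dang[OF line_nth[of i]]] by blast

lemma tight_inner:
  assumes "Suc (Suc i) < m"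
  shows "tight (Is ! Suc i) (Is ! i)" "tight (Is ! Suc i) (Is ! Suc (Suc i))"
proof -
  have i: "i < m" "Suc i < m" using assms by simp_all
  have meet: "Is ! Suc i \<inter> Is ! i \<noteq> {}" "Is ! Suc i \<inter> Is ! Suc (Suc i) \<noteq> {}"
    using consecutive_lines_meet[OF i(2)] consecutive_lines_meet[OF assms] by (simp_all add: Int_commute)
  have ne: "Is ! Suc i \<noteq> Is ! i" "Is ! Suc i \<noteq> Is ! Suc (Suc i)" "Is ! i \<noteq> Is ! Suc (Suc i)"
    using nth_lines_neq i assms by simp_all
  show "tight (Is ! Suc i) (Is ! i)" "tight (Is ! Suc i) (Is ! Suc (Suc i))"
    using two_neighbours_tight[OF line_nth[OF i(2)] line_nth[OF i(1)] line_nth[OF assms] ne meet] by blast+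
qed

text \<open>With at least three lines, one of two consecutive ones has a second neighbour.\<close>

lemma tight_consecutive:
  assumes "Suc i < m"
  shows "tight (Is ! i) (Is ! Suc i)"
proof (cases i)
  case 0
  then show ?thesis using tight_inner(1)[of 0] len tight_sym by simp
next
  case (Suc j)
  then show ?thesis using tight_inner(2)[of j] assms by simp
qed

lemma D_nonconsecutive_disjoint:
  assumes "j < m" "Suc i < j"
  shows "A i \<inter> A j = {}"
proof -
  have "tight (Is ! i) (Is ! Suc i)" using tight_consecutive assms by simp
  moreover have "tight (Is ! j) (Is ! (j - 1))" using tight_consecutive[of "j - 1"] assms tight_sym by simp
  ultimately show ?thesis using tight_D_disjoint nonconsecutive_lines_disjoint assms by blast
qed

lemma D_inner:
  assumes "Suc (Suc i) < m"
  shows "A (Suc i) \<subseteq> A i \<union> A (Suc (Suc i))" "A (Suc i) \<inter> A i \<inter> A (Suc (Suc i)) = {}" "odd k"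
proof -
  obtain e f where ef: "e \<in> Is ! Suc i" "e \<in> Is ! i" "f \<in> Is ! Suc i" "f \<in> Is ! Suc (Suc i)"
    using consecutive_lines_meet[of i] consecutive_lines_meet[of "Suc i"] assms by auto
  show "A (Suc i) \<subseteq> A i \<union> A (Suc (Suc i))" "A (Suc i) \<inter> A i \<inter> A (Suc (Suc i)) = {}" "odd k"
    using two_neighbours(4,5,6)[OF line_nth line_nth line_nth nth_lines_neq nth_lines_neq nth_lines_neq ef] assms by auto
qed

text \<open>An inner set is covered by its two neighbours, so a vertex lying in only one set belongs
  to an end block.\<close>

lemma D_nth_cases:
  assumes "j < m" "v \<in> A j"
  obtains "v \<in> A 0 - A 1" | "v \<in> A (m - 1) - A (m - 2)" | t where "Suc t < m" "v \<in> A t" "v \<in> A (Suc t)"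
proof -
  consider "j = 0" | "j = m - 1" "j \<noteq> 0" | i where "j = Suc i" "Suc (Suc i) < m"
    using assms(1) by (cases j) force+
  then show thesis
  proof cases
    case 1
    show thesis
    proof (cases "v \<in> A 1")
      case True
      then show thesis using that(3)[of 0] assms len 1 by simp
    qed (use that assms 1 in blast)
  next
    case 2
    have m: "m - 1 = Suc (m - 2)" using len by simp
    show thesis
    proof (cases "v \<in> A (m - 2)")
      case True
      then show thesis using that(3)[of "m - 2"] assms len 2 m by simp
    qed (use that assms 2 in blast)
  next
    case 3
    then have "v \<in> A i \<or> v \<in> A (Suc (Suc i))" using D_inner(1)[of i] assms by blast
    then show thesis using that(3)[of i] that(3)[of "Suc i"] 3 assms by auto
  qed
qed

lemma tight_first: "tight (Is ! 0) (Is ! 1)" using tight_consecutive[of 0] len by simp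

lemma tight_last: "tight (Is ! (m - 1)) (Is ! (m - 2))"
proof -
  have "m - 1 = Suc (m - 2)" using len by simp
  then show ?thesis using tight_consecutive[of "m - 2"] tight_sym len by simp
qed

text \<open>Exactly \<open>(k - 1) / 2\<close> of the \<open>k\<close> edges of the end block go to
  the intersection and at least one goes to \<open>s\<close>.\<close>

lemma end_to_uncovered:
  assumes t: "tight F F1"
  shows "2 * b (D F - D F1) uncovered + 1 \<le> k"
proof -
  have l: "line F" using t by (simp add: tight_def)
  have "uncovered \<subseteq> verts G - {s} - D F" using l by blast
  from end_part_degree[OF t this] show ?thesis
    using tight_end_counts[OF t] card_line[OF l] by linarith
qed

text \<open>Only the two end blocks can send edges to uncovered vertices, together at most
  \<open>k - 1\<close>, while a nonempty uncovered set needs \<open>k\<close>.\<close>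

lemma path_covers: "uncovered = {}"
proof (rule ccontr)
  assume "uncovered \<noteq> {}"
  then have "k \<le> d uncovered" by (rule uncovered_ge)
  moreover have "cut G uncovered \<subseteq>
    cut_between G (A 0 - A 1) uncovered \<union> cut_between G (A (m - 1) - A (m - 2)) uncovered"
  proof
    fix h assume "h \<in> cut G uncovered"
    then show "h \<in> cut_between G (A 0 - A 1) uncovered \<union> cut_between G (A (m - 1) - A (m - 2)) uncovered"
    proof (rule uncovered_edge)
      fix x y F assume h: "h \<in> edges G" "ends G h = {x, y}" "x \<in> uncovered" "line F" "y \<in> D F"
        and no: "\<And>F1 F2. line F1 \<Longrightarrow> line F2 \<Longrightarrow> F1 \<noteq> F2 \<Longrightarrow> F1 \<inter> F2 \<noteq> {} \<Longrightarrow> y \<in> D F1 \<Longrightarrow> y \<notin> D F2"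
      obtain j where j: "j < m" "F = Is ! j" using line_index h(4) by blast
      have "y \<in> A j" using h j by simp
      from j(1) this show ?thesis
      proof (cases rule: D_nth_cases)
        case 1
        then show ?thesis using in_cut_between_iff[OF h(1,2)] h(3) by blast
      next
        case 2
        then show ?thesis using in_cut_between_iff[OF h(1,2)] h(3) by blast
      next
        case (3 t)
        then show ?thesis using no[of "Is ! t" "Is ! Suc t"] line_nth nth_lines_neq consecutive_lines_meet by simp
      qed
    qed
  qed
  then have "d uncovered \<le> card (cut_between G (A 0 - A 1) uncovered \<union> cut_between G (A (m - 1) - A (m - 2)) uncovered)"
    by (intro card_mono finite_UnI finite_cut_between[OF G])
  then have "d uncovered \<le> b (A 0 - A 1) uncovered + b (A (m - 1) - A (m - 2)) uncovered"
    using card_Un_le order_trans by blast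
  ultimately show False
    using end_to_uncovered[OF tight_first] end_to_uncovered[OF tight_last] by linarith
qed

text \<open>Any other target \<open>y\<close> lies in two consecutive sets \<open>A t\<close> and
  \<open>A (Suc t)\<close> with \<open>t > 0\<close>. Its neighbour \<open>x\<close> would lie in
  one of them, but the first end block is disjoint from every set other than
  \<open>A 0\<close>.\<close>

lemma no_edges_from_first_end:
  "cut_between G (A 0 - A 1) (verts G - {s} - A 0 - (A (m - 1) - A (m - 2))) = {}"
proof (rule ccontr)
  assume "\<not> ?thesis"
  then obtain h where "h \<in> cut_between G (A 0 - A 1) (verts G - {s} - A 0 - (A (m - 1) - A (m - 2)))" by blast
  then obtain x y where h: "h \<in> edges G" "ends G h = {x, y}" "x \<in> A 0 - A 1"
    and y: "y \<in> verts G - {s} - A 0 - (A (m - 1) - A (m - 2))"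
    using cut_between_obtain by metis
  have "y \<in> (\<Union>F\<in>{F. line F}. D F)" using path_covers y by blast
  then obtain F where F: "line F" "y \<in> D F" by blast
  then obtain j where j: "j < m" "y \<in> A j" using line_index by metis
  from j show False
  proof (cases rule: D_nth_cases)
    case 1
    then show False using y by blast
  next
    case 2
    then show False using y by blast
  next
    case (3 t)
    have "t \<noteq> 0" using y 3(2) by (metis DiffD1 DiffD2)
    have yx: "ends G h = {y, x}" using h by (simp add: insert_commute)
    have "x \<noteq> s" using h(3) D_nth_subset[OF length_bounds(1)] by blast
    then have x: "x \<in> A t \<union> A (Suc t)"
      using edge_at_intersection[OF line_nth line_nth nth_lines_neq consecutive_lines_meet h(1) yx] 3 by simp
    have "x \<notin> A (Suc t)" using D_nonconsecutive_disjoint[of "Suc t" 0] 3 \<open>t \<noteq> 0\<close> h(3) by auto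
    moreover have "x \<notin> A t"
    proof (cases "t = 1")
      case False
      then show ?thesis using D_nonconsecutive_disjoint[of t 0] 3 \<open>t \<noteq> 0\<close> h(3) by auto
    qed (use h in simp)
    ultimately show False using x by blast
  qed
qed

lemma first_last_disjoint: "A 0 \<inter> A (m - 1) = {}" using D_nonconsecutive_disjoint[of "m - 1" 0] len by simp

text \<open>The degree count \<open>k = (k - 1) / 2 + (l - 1) + b\<close> of the first end block,
  cleared of fractions.\<close>

lemma edges_between_ends: "2 * (b (A 0 - A 1) (A (m - 1) - A (m - 2)) + card (Is ! 0)) = k + 3"
proof -
  have "A (m - 1) \<subseteq> verts G - {s}" by (rule D_nth_subset[OF length_bounds(3)])
  then have "A (m - 1) - A (m - 2) \<subseteq> verts G - {s} - A 0" using first_last_disjoint by blast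
  from end_part_degree[OF tight_first this] show ?thesis
    using tight_end_counts[OF tight_first] no_edges_from_first_end by simp
qed

lemma no_edges_first_end_last_intersection: "cut_between G (A 0 - A 1) (A (m - 1) \<inter> A (m - 2)) = {}"
proof -
  have "A (m - 1) \<subseteq> verts G - {s}" by (rule D_nth_subset[OF length_bounds(3)])
  then have "A (m - 1) \<inter> A (m - 2) \<subseteq> verts G - {s} - A 0 - (A (m - 1) - A (m - 2))"
    using first_last_disjoint by blast
  from cut_between_mono[OF subset_refl this, of G "A 0 - A 1"]
  show ?thesis unfolding no_edges_from_first_end by simp
qed

text \<open>Such an edge would have its end \<open>y\<close> in \<open>A 0\<close> or
  \<open>A 1\<close>, both disjoint from the last set when \<open>m \<ge> 4\<close>.\<close>

lemma edges_between_intersections_long: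
  assumes "m \<ge> 4"
  shows "cut_between G (A 0 \<inter> A 1) (A (m - 1) \<inter> A (m - 2)) = {}"
proof (rule ccontr)
  assume "\<not> ?thesis"
  then obtain h where "h \<in> cut_between G (A 0 \<inter> A 1) (A (m - 1) \<inter> A (m - 2))" by blast
  then obtain x y where h': "h \<in> edges G" "ends G h = {x, y}" "x \<in> A 0 \<inter> A 1" "y \<in> A (m - 1) \<inter> A (m - 2)"
    using cut_between_obtain by metis
  then have h: "h \<in> edges G" "ends G h = {x, y}" "x \<in> A 0" "x \<in> A 1" "y \<in> A (m - 1)" by blast+
  have "y \<noteq> s" using h(5) D_nth_subset[OF length_bounds(3)] by blast
  then have "y \<in> A 0 \<union> A 1"
    using edge_at_intersection[OF line_nth[OF length_bounds(1)] line_nth[OF length_bounds(2)] nth_lines_neq[OF length_bounds(1,2)] _ h(1-4)]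
      consecutive_lines_meet[of 0] length_bounds by simp
  moreover have "Suc 0 < m - 1" "Suc 1 < m - 1" using assms by linarith+
  ultimately show False
    using D_nonconsecutive_disjoint[OF length_bounds(3), of 0] D_nonconsecutive_disjoint[OF length_bounds(3), of 1] h(5) by blast
qed

text \<open>The second intersection is now \<open>A 1 - A 0\<close>, so the edges in question are
  those counted by \<open>b P R\<close> in the crossing of \<open>A 0\<close> and
  \<open>A 1\<close>.\<close>

lemma edges_between_intersections_three:
  assumes "m = 3"
  shows "2 * b (A 0 \<inter> A 1) (A (m - 1) \<inter> A (m - 2)) + 1 = k"
proof -
  have eq: "A (m - 1) \<inter> A (m - 2) = A 1 - A 0" using D_inner(1,2)[of 0] assms by (auto simp: numeral_2_eq_2)
  obtain e where e: "e \<in> Is ! 0" "e \<in> Is ! 1" using consecutive_lines_meet[of 0] assms by auto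
  have l: "line (Is ! 0)" "line (Is ! 1)" "Is ! 0 \<noteq> Is ! 1" using line_nth nth_lines_neq assms by auto
  have "d (A 0 \<inter> A 1) = k" using tight_first by (simp add: tight_def)
  then show ?thesis using adjacent_crossing(3,5)[OF l e] unfolding eq by simp
qed

text \<open>Facts about the first end transfer to the last end by reading the path
  backwards.\<close>

lemma reverse_setting: "long_path_setting G s k (rev Is)"
  by unfold_locales (use path len is_path_seq_rev in auto)

lemma rev_nths: "rev Is ! 0 = Is ! (m - 1)" "rev Is ! 1 = Is ! (m - 2)"
  "rev Is ! (m - 1) = Is ! 0" "rev Is ! (m - 2) = Is ! 1"
proof -
  have "m - Suc (m - 1) = 0" "m - Suc (m - 2) = 1" "m - Suc 0 = m - 1" "m - Suc 1 = m - 2"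
    using len by linarith+
  then show "rev Is ! 0 = Is ! (m - 1)" "rev Is ! 1 = Is ! (m - 2)"
    "rev Is ! (m - 1) = Is ! 0" "rev Is ! (m - 2) = Is ! 1"
    using length_bounds by (simp_all only: rev_nth)
qed

theorem path_ends:
  "card (Is ! 0) = card (Is ! (m - 1))" "2 * card (Is ! 0) \<le> k + 3"
  "m \<ge> 4 \<Longrightarrow> 2 * (b (A 0) (A (m - 1)) + card (Is ! 0)) = k + 3"
  "m = 3 \<Longrightarrow> b (A 0) (A (m - 1)) + card (Is ! 0) = k + 1"
proof -
  interpret r: long_path_setting G s k "rev Is" by (rule reverse_setting)
  let ?P0 = "A 0 - A 1" and ?P1 = "A 0 \<inter> A 1" and ?Q0 = "A (m - 1) - A (m - 2)" and ?Q1 = "A (m - 1) \<inter> A (m - 2)"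
  have rev: "2 * (b ?Q0 ?P0 + card (Is ! (m - 1))) = k + 3" "cut_between G ?Q0 ?P1 = {}"
    using r.edges_between_ends r.no_edges_first_end_last_intersection by (simp_all only: length_rev rev_nths)
  \<comment> \<open>Counting the edges between the end blocks from either side gives the same
    number, hence equal line sizes.\<close>
  show "card (Is ! 0) = card (Is ! (m - 1))"
    using edges_between_ends rev(1) cut_between_commute[of G ?P0 ?Q0] by simp
  show "2 * card (Is ! 0) \<le> k + 3" using edges_between_ends by simp
  have split: "A 0 = ?P0 \<union> ?P1" "A (m - 1) = ?Q0 \<union> ?Q1" by blast+
  have "b (A 0) (A (m - 1)) = b ?P0 (A (m - 1)) + b ?P1 (A (m - 1))"
    by (subst split(1), rule card_cut_between_Un(1)[OF G]) (use first_last_disjoint in blast)+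
  also have "b ?P0 (A (m - 1)) = b ?P0 ?Q0 + b ?P0 ?Q1"
    by (subst split(2), rule card_cut_between_Un(2)[OF G]) (use first_last_disjoint in blast)+
  also have "b ?P1 (A (m - 1)) = b ?P1 ?Q0 + b ?P1 ?Q1"
    by (subst split(2), rule card_cut_between_Un(2)[OF G]) (use first_last_disjoint in blast)+
  also have "b ?P1 ?Q0 = 0"
    unfolding cut_between_commute[of G ?P1 ?Q0] rev(2) by simp
  finally have sum: "b (A 0) (A (m - 1)) = b ?P0 ?Q0 + b ?P1 ?Q1"
    using no_edges_first_end_last_intersection by simp
  show "m \<ge> 4 \<Longrightarrow> 2 * (b (A 0) (A (m - 1)) + card (Is ! 0)) = k + 3"
    using sum edges_between_ends edges_between_intersections_long by simp
  show "m = 3 \<Longrightarrow> b (A 0) (A (m - 1)) + card (Is ! 0) = k + 1"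
    using sum edges_between_ends edges_between_intersections_three by simp
qed

text \<open>\<open>E i\<close> is the edge shared by lines \<open>i\<close> and
  \<open>Suc i\<close>. Each inner line is the pair of its two shared edges, so the inner lines
  contribute exactly the links of the path through the \<open>E i\<close>; the two end lines are the
  cliques.\<close>

theorem complement_two_cliques:
  "\<exists>p. two_cliques_joined_by_path (complement L) (Is ! 0) (Is ! (m - 1)) p"
proof -
  have "\<forall>i. \<exists>e. Suc i < m \<longrightarrow> e \<in> Is ! i \<and> e \<in> Is ! Suc i" using consecutive_lines_meet by blast
  then obtain E where E: "\<And>i. Suc i < m \<Longrightarrow> E i \<in> Is ! i" "\<And>i. Suc i < m \<Longrightarrow> E i \<in> Is ! Suc i" by metis
  have mem: "E i \<in> Is ! j \<longleftrightarrow> j = i \<or> j = Suc i" if "Suc i < m" "j < m" for i j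
  proof
    assume e: "E i \<in> Is ! j"
    show "j = i \<or> j = Suc i"
    proof (rule ccontr)
      assume "\<not> ?thesis"
      then have "Is ! i \<noteq> Is ! Suc i" "Is ! i \<noteq> Is ! j" "Is ! Suc i \<noteq> Is ! j"
        using nth_lines_neq that by auto
      then show False
        using not_three_lines[of "Is ! i" "Is ! Suc i" "Is ! j" "E i"] that line_nth E[OF that(1)] e by simp
    qed
  qed (use E that in auto)
  have inner: "Is ! Suc i = {E i, E (Suc i)}" if "Suc (Suc i) < m" for i
    using two_neighbours(2)[of "Is ! Suc i" "Is ! i" "Is ! Suc (Suc i)" "E i" "E (Suc i)"] that line_nth nth_lines_neq E by simp
  have Eeq: "E i = E j \<longleftrightarrow> i = j" if "Suc i < m" "Suc j < m" for i j
  proof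
    assume "E i = E j"
    then have "E i \<in> Is ! j" "E i \<in> Is ! Suc j" using E[OF that(2)] by simp_all
    then have "j = i \<or> j = Suc i" "Suc j = i \<or> Suc j = Suc i"
      using mem[OF that(1)] that(2) by simp_all
    then show "i = j" by linarith
  qed simp
  define p where "p = map E [0..<m - 1]"
  have lp: "length p = m - 1" and pn: "\<And>i. i < m - 1 \<Longrightarrow> p ! i = E i" by (simp_all add: p_def)
  have p0: "p \<noteq> []" using lp len by auto
  have hd: "hd p = E 0" and last: "last p = E (m - 2)"
    using p0 pn[of 0] pn[of "m - 2"] lp len by (simp_all add: hd_conv_nth last_conv_nth numeral_2_eq_2)
  have setp: "set p = E ` {..<m - 1}" by (auto simp: p_def)
  have dist: "distinct p" using Eeq by (auto simp: p_def distinct_map inj_on_def)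
  have lines: "{F. line F} = (!) Is ` {..<m}" using line_nth line_index by blast
  have K: "Is ! 0 \<inter> set p = {hd p}"
  proof -
    have "E i \<in> Is ! 0 \<longleftrightarrow> i = 0" if "i < m - 1" for i using mem[OF _ length_bounds(1), of i] that by auto
    then show ?thesis unfolding setp hd using len by auto
  qed
  have K': "Is ! (m - 1) \<inter> set p = {last p}"
  proof -
    have "E i \<in> Is ! (m - 1) \<longleftrightarrow> i = m - 2" if "i < m - 1" for i using mem[of i "m - 1"] that by auto
    then show ?thesis unfolding setp last using len by auto
  qed
  have KK: "Is ! 0 \<inter> Is ! (m - 1) = {}" using nonconsecutive_lines_disjoint[of "m - 1" 0] len by simp
  have split: "{..<m} = {0, m - 1} \<union> Suc ` {..<m - 2}"
  proof (intro set_eqI iffI)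
    fix i assume "i \<in> {..<m}"
    then show "i \<in> {0, m - 1} \<union> Suc ` {..<m - 2}" by (cases i) auto
  qed (use len in auto)
  have N: "S = Is ! 0 \<union> Is ! (m - 1) \<union> set p"
  proof
    have "S = (\<Union>i\<in>{..<m}. Is ! i)" using Union_lines lines by simp
    also have "\<dots> = Is ! 0 \<union> Is ! (m - 1) \<union> (\<Union>i\<in>{..<m - 2}. Is ! Suc i)" unfolding split by auto
    also have "(\<Union>i\<in>{..<m - 2}. Is ! Suc i) \<subseteq> set p" unfolding setp using inner by auto
    finally show "S \<subseteq> Is ! 0 \<union> Is ! (m - 1) \<union> set p" by blast
    have "E i \<in> S" if "i < m - 1" for i
    proof -
      have "Suc i < m" "i < m" using that by linarith+
      then show ?thesis using E(1) line_subset[OF line_nth] by blast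
    qed
    then show "Is ! 0 \<union> Is ! (m - 1) \<union> set p \<subseteq> S"
      unfolding setp using line_subset[OF line_nth[OF length_bounds(1)]] line_subset[OF line_nth[OF length_bounds(3)]] by auto
  qed
  have "links (complement L) = (\<Union>i\<in>{..<m}. pairs (Is ! i))" unfolding links_complement_L lines by simp
  also have "\<dots> = pairs (Is ! 0) \<union> pairs (Is ! (m - 1)) \<union> (\<Union>i\<in>{..<m - 2}. pairs (Is ! Suc i))"
    unfolding split by auto
  also have "(\<Union>i\<in>{..<m - 2}. pairs (Is ! Suc i)) = path_links p"
  proof -
    have "pairs (Is ! Suc i) = {{p ! i, p ! Suc i}}" if "i < m - 2" for i
    proof -
      have i: "Suc i < m" "Suc (Suc i) < m" "i < m - 1" "Suc i < m - 1" using that by linarith+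
      show ?thesis
        using Eeq[OF i(1,2)] unfolding inner[OF i(2)] pn[OF i(3)] pn[OF i(4)] by (intro pairs_doubleton) simp
    qed
    then have "(\<Union>i\<in>{..<m - 2}. pairs (Is ! Suc i)) = (\<Union>i\<in>{..<m - 2}. {{p ! i, p ! Suc i}})" by simp
    also have "\<dots> = path_links p"
    proof -
      have "i \<in> {..<m - 2} \<longleftrightarrow> Suc i < length p" for i unfolding lp by auto
      then show ?thesis unfolding path_links_def by blast
    qed
    finally show ?thesis .
  qed
  finally have Lk: "links (complement L) = pairs (Is ! 0) \<union> pairs (Is ! (m - 1)) \<union> path_links p" .
  have "length p \<noteq> 1" using lp len by simp
  then show ?thesis
    unfolding two_cliques_joined_by_path_def nodes_complement_L
    using p0 dist K K' KK N Lk by auto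
qed

end

section \<open>Cycles and the structure theorem\<close>

lemma real_halves:
  fixes x k l :: nat
  shows "2 * x \<le> k + 3 \<Longrightarrow> real x \<le> (real k + 3) / 2"
    and "2 * (x + l) = k + 3 \<Longrightarrow> real x = (real k + 3) / 2 - real l"
    and "x + l = k + 1 \<Longrightarrow> real x = real k + 1 - real l"
proof -
  show "real x \<le> (real k + 3) / 2" if "2 * x \<le> k + 3"
    using iffD2[OF of_nat_le_iff[where 'a = real] that] by simp
  show "real x = (real k + 3) / 2 - real l" if "2 * (x + l) = k + 3"
    using arg_cong[OF that, of real] by (simp add: field_simps)
  show "real x = real k + 1 - real l" if "x + l = k + 1"
    using arg_cong[OF that, of real] by simp
qed

context connected_lifting_setting begin

text \<open>Every line has two neighbours, so it is a pair of consecutive shared edges, and every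
  vertex of its dangerous set also lies in a neighbouring one. By \<open>uncovered_edge\<close> no
  edge can then leave the uncovered set.\<close>

lemma cycle_facts:
  assumes "is_cycle I"
  shows "is_cycle (complement L)" "odd k" "uncovered = {}"
proof -
  obtain c where len: "length c \<ge> 3" and dist: "distinct c" and nodes: "nodes I = set c"
    and links: "links I = insert {last c, hd c} (path_links c)"
    using assms unfolding is_cycle_def by blast
  define m where "m = length c"
  \<comment> \<open>The cyclic successor.\<close>
  define nx where "nx = (\<lambda>i. if Suc i = m then 0 else Suc i)"
  have m3: "m \<ge> 3" using len by (simp add: m_def)
  have nx: "nx i < m" "nx i \<noteq> i" "nx (nx i) \<noteq> i" "nx (nx i) \<noteq> nx i" if "i < m" for i
    using that m3 by (auto simp: nx_def)
  have prev: "\<exists>i<m. j = nx i" if "j < m" for j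
  proof (cases j)
    case 0
    then have "m - 1 < m \<and> j = nx (m - 1)" using m3 by (simp add: nx_def)
    then show ?thesis by blast
  next
    case (Suc i)
    then have "i < m \<and> j = nx i" using that by (simp add: nx_def)
    then show ?thesis by blast
  qed
  have line: "line (c ! i)" if "i < m" for i
    using that nodes nth_mem[of i c] unfolding nodes_I m_def by blast
  have ne: "c ! i \<noteq> c ! j" if "i < m" "j < m" "i \<noteq> j" for i j
    using that dist by (simp add: nth_eq_iff_index_eq m_def)
  have lines: "{F. line F} = (!) c ` {..<m}"
    using nodes unfolding nodes_I m_def by (auto simp: set_conv_nth)
  have meet: "c ! i \<inter> c ! nx i \<noteq> {}" if i: "i < m" for i
  proof -
    have "{c ! i, c ! nx i} \<in> links I"
    proof (cases "Suc i = m")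
      case True
      have "c \<noteq> []" using len by auto
      moreover have "i = length c - 1" "nx i = 0" using True by (auto simp: nx_def m_def)
      ultimately have "c ! i = last c" "c ! nx i = hd c"
        by (simp_all add: last_conv_nth hd_conv_nth)
      then show ?thesis using links by simp
    next
      case False
      then have "{c ! i, c ! nx i} \<in> path_links c" using i unfolding path_links_def nx_def m_def by auto
      then show ?thesis using links by simp
    qed
    then show ?thesis using links_I_iff by blast
  qed
  then have "\<forall>i. \<exists>e. i < m \<longrightarrow> e \<in> c ! i \<and> e \<in> c ! nx i" by blast
  then obtain E where E: "\<And>i. i < m \<Longrightarrow> E i \<in> c ! i" "\<And>i. i < m \<Longrightarrow> E i \<in> c ! nx i" by metis
  have nb: "c ! nx i = {E i, E (nx i)} \<and> E i \<noteq> E (nx i) \<and> odd k \<and>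
      D (c ! nx i) \<subseteq> D (c ! i) \<union> D (c ! nx (nx i))" if i: "i < m" for i
  proof -
    note n = nx[OF i]
    note n2 = nx(1)[OF n(1)]
    have 1: "c ! nx i \<noteq> c ! i" "c ! nx i \<noteq> c ! nx (nx i)" "c ! i \<noteq> c ! nx (nx i)"
      using ne[OF n(1) i] ne[OF n(1) n2] ne[OF i n2] n by metis+
    show ?thesis
      using two_neighbours(1,2,4,6)[OF line[OF n(1)] line[OF i] line[OF n2] 1 E(2)[OF i] E(1)[OF i] E(1)[OF n(1)] E(2)[OF n(1)]]
      by blast
  qed
  show "odd k" using nb[of 0] m3 by simp
  have mem: "t = i \<or> t = nx i" if i: "i < m" and t: "t < m" and e: "E i \<in> c ! t" for i t
  proof (rule ccontr)
    assume "\<not> ?thesis"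
    then have 1: "c ! i \<noteq> c ! nx i" "c ! i \<noteq> c ! t" "c ! nx i \<noteq> c ! t"
      using ne[OF i nx(1)[OF i]] ne[OF i t] ne[OF nx(1)[OF i] t] nx(2)[OF i] by metis+
    show False
      by (rule not_three_lines[OF line[OF i] line[OF nx(1)[OF i]] line[OF t] 1 E(1)[OF i] E(2)[OF i] e])
  qed
  have inj: "i = j" if i: "i < m" and j: "j < m" and eq: "E i = E j" for i j
  proof (rule ccontr)
    assume "i \<noteq> j"
    have "E i \<in> c ! j" "E i \<in> c ! nx j" using E[OF j] eq by simp_all
    then have "j = i \<or> j = nx i" "nx j = i \<or> nx j = nx i" using mem[OF i] j nx(1)[OF j] by blast+
    then show False using \<open>i \<noteq> j\<close> nx[OF i] by metis
  qed
  define es where "es = map E [0..<m]"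
  have les: "length es = m" and en: "\<And>i. i < m \<Longrightarrow> es ! i = E i" by (simp_all add: es_def)
  have dist: "distinct es" using inj by (auto simp: es_def distinct_map inj_on_def)
  have range: "{..<m} = nx ` {..<m}"
  proof
    show "{..<m} \<subseteq> nx ` {..<m}" using prev by auto
    show "nx ` {..<m} \<subseteq> {..<m}" using nx(1) by auto
  qed
  \<comment> \<open>Line \<open>nx i\<close>, not \<open>i\<close>, is the pair
    \<open>{E i, E (nx i)}\<close>; since \<open>nx\<close> is onto, all lines have this
    form.\<close>
  have lines': "{F. line F} = (\<lambda>i. {E i, E (nx i)}) ` {..<m}"
  proof -
    have "{F. line F} = (\<lambda>i. c ! nx i) ` {..<m}" unfolding lines by (subst range) (simp add: image_image)
    also have "\<dots> = (\<lambda>i. {E i, E (nx i)}) ` {..<m}" using nb by (intro image_cong) auto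
    finally show ?thesis .
  qed
  have N: "S = set es"
  proof -
    have "S = (\<Union>i\<in>{..<m}. {E i, E (nx i)})" using Union_lines lines' by simp
    also have "\<dots> = E ` {..<m}" using nx(1) by auto
    finally show ?thesis by (simp add: es_def atLeast0LessThan)
  qed
  have "links (complement L) = (\<Union>i\<in>{..<m}. pairs {E i, E (nx i)})"
    unfolding links_complement_L lines' by simp
  also have "\<dots> = (\<Union>i\<in>{..<m}. {{E i, E (nx i)}})" using nb by (intro SUP_cong) (auto simp: pairs_doubleton)
  also have "\<dots> = insert {last es, hd es} (path_links es)"
  proof -
    have es0: "es \<noteq> []" using les m3 by auto
    have last: "last es = E (m - 1)" "hd es = E 0"
      using es0 les en[of "m - 1"] en[of 0] m3 by (simp_all add: last_conv_nth hd_conv_nth)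
    have "{..<m} = insert (m - 1) {i. Suc i < m}" using m3 by auto
    then have "(\<Union>i\<in>{..<m}. {{E i, E (nx i)}}) = insert {E (m - 1), E (nx (m - 1))} (\<Union>i\<in>{i. Suc i < m}. {{E i, E (nx i)}})"
      by simp
    also have "nx (m - 1) = 0" using m3 by (simp add: nx_def)
    also have "(\<Union>i\<in>{i. Suc i < m}. {{E i, E (nx i)}}) = path_links es"
    proof -
      have "{E i, E (nx i)} = {es ! i, es ! Suc i}" if "Suc i < m" for i
        using that en[of i] en[of "Suc i"] by (simp add: nx_def)
      then show ?thesis unfolding path_links_def les by blast
    qed
    finally show ?thesis using last by simp
  qed
  finally have "links (complement L) = insert {last es, hd es} (path_links es)" .
  then show "is_cycle (complement L)"
    unfolding is_cycle_def using dist N les m3 nodes_complement_L by (intro exI[of _ es]) simp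
  show "uncovered = {}"
  proof (rule ccontr)
    assume "uncovered \<noteq> {}"
    then have "k \<le> d uncovered" by (rule uncovered_ge)
    then have "cut G uncovered \<noteq> {}" using k2 by auto
    then obtain h where "h \<in> cut G uncovered" by blast
    then show False
    proof (rule uncovered_edge)
      fix x y F assume F: "line F" "y \<in> D F"
        and no: "\<And>F1 F2. line F1 \<Longrightarrow> line F2 \<Longrightarrow> F1 \<noteq> F2 \<Longrightarrow> F1 \<inter> F2 \<noteq> {} \<Longrightarrow> y \<in> D F1 \<Longrightarrow> y \<notin> D F2"
      obtain j where j: "j < m" "F = c ! j" using F(1) lines by blast
      obtain i where i: "i < m" "j = nx i" using prev[OF j(1)] by blast
      note n = nx[OF i(1)]
      have "y \<in> D (c ! i) \<or> y \<in> D (c ! nx (nx i))" using nb[OF i(1)] F j i by blast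
      moreover have "c ! i \<noteq> c ! nx i" "c ! nx i \<noteq> c ! nx (nx i)"
        using ne[OF i(1) n(1)] ne[OF n(1) nx(1)[OF n(1)]] n by metis+
      ultimately show False
        using no[OF line[OF i(1)] line[OF n(1)] _ meet[OF i(1)]]
          no[OF line[OF n(1)] line[OF nx(1)[OF n(1)]] _ meet[OF n(1)]] F j i by blast
    qed
  qed
qed

section \<open>Collecting the conclusions\<close>

lemma long_path_odd:
  assumes "n \<ge> 2" "is_path_of_length I n"
  shows "odd k"
proof -
  obtain p where p: "is_path_seq I p" "length p = n + 1" using assms unfolding is_path_of_length_def by blast
  interpret long_path_setting G s k p by unfold_locales (use p assms in auto)
  show ?thesis using tight_first by (simp add: tight_def)
qed

lemma two_path:
  assumes "is_path_seq I Is" "length Is = 2"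
  shows "\<exists>F1 F2 e. {F. line F} = {F1, F2} \<and> F1 \<noteq> F2 \<and> e \<in> F1 \<and> e \<in> F2"
proof -
  obtain F1 F2 where Is: "Is = [F1, F2]"
    using assms(2) by (auto simp: length_Suc_conv numeral_2_eq_2)
  have 1: "{F. line F} = {F1, F2}" "F1 \<noteq> F2" using assms(1) unfolding Is is_path_seq_def nodes_I by auto
  have "{F1, F2} \<in> links I"
    using assms(1) unfolding Is is_path_seq_def by (simp add: path_links_Cons)
  then obtain e where "e \<in> F1" "e \<in> F2" using links_I_iff by blast
  then show ?thesis using 1 by metis
qed

lemma all_covered: "uncovered = {}"
  using cycle_or_path
proof
  assume "is_cycle I"
  then show ?thesis by (rule cycle_facts)
next
  assume "is_path I"
  then obtain p where p: "is_path_seq I p" unfolding is_path_def is_path_of_length_def by blast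
  consider "length p = 2" | "length p \<ge> 3" using path_seq_length[OF p] by linarith
  then show ?thesis
  proof cases
    case 1
    obtain F1 F2 e where "{F. line F} = {F1, F2}" "F1 \<noteq> F2" "e \<in> F1" "e \<in> F2"
      using two_path[OF p 1] by (elim exE conjE)
    then show ?thesis by (rule two_lines(1))
  next
    case 2
    interpret long_path_setting G s k p by unfold_locales (use p 2 in auto)
    show ?thesis by (rule path_covers)
  qed
qed

lemma Union_dangerous_sets: "\<Union> {D F |F. line F} = verts G - {s}"
proof -
  have "D F \<subseteq> verts G - {s}" if "line F" for F using dangD(1,2)[OF D_dang[OF that]] by blast
  then have "(\<Union>F\<in>{F. line F}. D F) = verts G - {s}" using all_covered by blast
  moreover have "{D F |F. line F} = D ` {F. line F}" by blast
  ultimately show ?thesis by simp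
qed

text \<open>The cliques are the two lines, joined by the path \<open>[e]\<close> of length 0. The
  pairs left for \<open>L\<close> run between the remainders of the lines, which have equal size by
  \<open>two_lines\<close>.\<close>

lemma two_lines_complement:
  assumes lines: "{F. line F} = {F1, F2}" and ne: "F1 \<noteq> F2" and e: "e \<in> F1" "e \<in> F2"
  shows "two_cliques_sharing_vertex (complement L) F1 F2"
    "two_cliques_joined_by_path (complement L) F1 F2 [e]"
    "isolated_plus_balanced_complete_bipartite L"
proof -
  note tl = two_lines[OF lines ne e]
  have lk: "links (complement L) = pairs F1 \<union> pairs F2" unfolding links_complement_L lines by simp
  show "two_cliques_sharing_vertex (complement L) F1 F2"
    unfolding two_cliques_sharing_vertex_def nodes_complement_L lk using tl(2,3) by simp
  show "two_cliques_joined_by_path (complement L) F1 F2 [e]"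
    unfolding two_cliques_joined_by_path_def nodes_complement_L lk
    using tl(2,3) e by (auto simp: path_links_def)
  have fin: "finite F1" "finite F2" using tl(2) fin_S by (metis finite_Un)+
  have "links L = pairs S - links (complement L)"
  proof -
    have "links L \<subseteq> pairs S" unfolding lifting_graph_def pairs_def by auto
    then show ?thesis unfolding complement_def nodes_L by auto
  qed
  also have "\<dots> = {{x, y} |x y. x \<in> F1 - {e} \<and> y \<in> F2 - {e}}"
  proof (intro set_eqI iffI)
    fix l assume "l \<in> pairs S - links (complement L)"
    then obtain x y where l: "l = {x, y}" "x \<in> S" "y \<in> S" "x \<noteq> y" "l \<notin> pairs F1" "l \<notin> pairs F2"
      unfolding lk pairs_def[of S] by blast
    then have "\<not> (x \<in> F1 \<and> y \<in> F1)" "\<not> (x \<in> F2 \<and> y \<in> F2)" unfolding pairs_def by blast+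
    moreover have "x \<in> F1 \<or> x \<in> F2" "y \<in> F1 \<or> y \<in> F2" using l tl(2) by blast+
    \<comment> \<open>Neither end is \<open>e\<close>, since \<open>e\<close> lies in both cliques
      and would share one with the other end.\<close>
    ultimately have "x \<in> F1 - {e} \<and> y \<in> F2 - {e} \<or> y \<in> F1 - {e} \<and> x \<in> F2 - {e}" using e by blast
    then show "l \<in> {{x, y} |x y. x \<in> F1 - {e} \<and> y \<in> F2 - {e}}"
      using l(1) insert_commute[of x y "{}"] by blast
  next
    fix l assume "l \<in> {{x, y} |x y. x \<in> F1 - {e} \<and> y \<in> F2 - {e}}"
    then obtain x y where l: "l = {x, y}" "x \<in> F1" "x \<noteq> e" "y \<in> F2" "y \<noteq> e" by blast
    then have "x \<notin> F2" "y \<notin> F1" using tl(3) by blast+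
    then have "l \<notin> pairs F1" "l \<notin> pairs F2" using l unfolding pairs_def by (auto simp: doubleton_eq_iff)
    moreover have "l \<in> pairs S" unfolding pairs_def using l tl(2) \<open>x \<notin> F2\<close> by blast
    ultimately show "l \<in> pairs S - links (complement L)" unfolding lk by blast
  qed
  finally show "isolated_plus_balanced_complete_bipartite L"
    unfolding isolated_plus_balanced_complete_bipartite_def nodes_L
    using tl(2,3,4) fin e
    by (intro exI[of _ e] exI[of _ "F1 - {e}"] exI[of _ "F2 - {e}"]) auto
qed

lemma path_length_one:
  assumes "is_path_of_length I 1"
  shows "\<exists>K K'. two_cliques_sharing_vertex (complement L) K K' \<and>
      real (card K) = (real (deg G s) + 1) / 2 \<and> real (card K') = (real (deg G s) + 1) / 2"
    "isolated_plus_balanced_complete_bipartite L"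
proof -
  obtain p where p: "is_path_seq I p" "length p = 2" using assms unfolding is_path_of_length_def by auto
  obtain F1 F2 e where F: "{F. line F} = {F1, F2}" "F1 \<noteq> F2" "e \<in> F1" "e \<in> F2"
    using two_path[OF p] by (elim exE conjE)
  have "real (card F1) = (real (deg G s) + 1) / 2" "real (card F2) = (real (deg G s) + 1) / 2"
    using two_lines(4,5)[OF F] by simp_all
  then show "\<exists>K K'. two_cliques_sharing_vertex (complement L) K K' \<and>
      real (card K) = (real (deg G s) + 1) / 2 \<and> real (card K') = (real (deg G s) + 1) / 2"
    using two_lines_complement(1)[OF F] by blast
  show "isolated_plus_balanced_complete_bipartite L" by (rule two_lines_complement(3)[OF F])
qed

lemma long_path_ends:
  assumes "is_path_seq I Is" "length Is \<ge> 3"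
    and A1: "A1 = D (hd Is)" and Am: "Am = D (last Is)" and l: "l = b {s} A1"
  shows "b {s} Am = l" "real l \<le> (real k + 3) / 2" "A1 \<inter> Am = {}"
    "length Is \<ge> 4 \<Longrightarrow> real (b A1 Am) = (real k + 3) / 2 - real l"
    "length Is = 3 \<Longrightarrow> real (b A1 Am) = real k + 1 - real l"
proof -
  interpret long_path_setting G s k Is by unfold_locales (use assms in auto)
  have "Is \<noteq> []" using len by auto
  then have h: "hd Is = Is ! 0" "last Is = Is ! (m - 1)" by (simp_all add: hd_conv_nth last_conv_nth)
  have c: "l = card (Is ! 0)" "b {s} Am = card (Is ! (m - 1))"
    using edges_into_D[OF line_nth[OF length_bounds(1)]] edges_into_D[OF line_nth[OF length_bounds(3)]]
    by (simp_all add: l A1 Am h)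
  show "b {s} Am = l" using c path_ends(1) by simp
  show "real l \<le> (real k + 3) / 2" unfolding c(1) by (rule real_halves(1)[OF path_ends(2)])
  show "A1 \<inter> Am = {}" unfolding A1 Am h by (rule first_last_disjoint)
  show "real (b A1 Am) = (real k + 3) / 2 - real l" if "m \<ge> 4"
    unfolding A1 Am h c(1) by (rule real_halves(2)[OF path_ends(3)[OF that]])
  show "real (b A1 Am) = real k + 1 - real l" if "m = 3"
    unfolding A1 Am h c(1) by (rule real_halves(3)[OF path_ends(4)[OF that]])
qed

lemma path_complement:
  assumes "is_path I"
  shows "\<exists>K K' p. two_cliques_joined_by_path (complement L) K K' p \<and>
    card K = card K' \<and> real (card K) \<le> (real k + 3) / 2"
proof -
  obtain p where p: "is_path_seq I p" using assms unfolding is_path_def is_path_of_length_def by blast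
  consider "length p = 2" | "length p \<ge> 3" using path_seq_length[OF p] by linarith
  then show ?thesis
  proof cases
    case 1
    obtain F1 F2 e where F: "{F. line F} = {F1, F2}" "F1 \<noteq> F2" "e \<in> F1" "e \<in> F2"
      using two_path[OF p 1] by (elim exE conjE)
    have "real (card F1) \<le> (real k + 3) / 2" by (rule real_halves(1)[OF two_lines(6)[OF F]])
    then show ?thesis using two_lines_complement(2)[OF F] two_lines(4)[OF F] by blast
  next
    case 2
    interpret long_path_setting G s k p by unfold_locales (use p 2 in auto)
    have "real (card (p ! 0)) \<le> (real k + 3) / 2" by (rule real_halves(1)[OF path_ends(2)])
    then show ?thesis using complement_two_cliques path_ends(1) by blast
  qed
qed

end

theorem theorem5p1:
  fixes G :: "('v, 'e) mgraph" and s :: 'v and k :: nat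
    and L :: "'e sgraph" and I :: "'e set sgraph"
  assumes "multigraph G"
    and "sk_edge_connected G s k"
    and "k \<ge> 2"
    and "deg G s \<ge> 4"
    and L_eq: "L = lifting_graph G s k"
    and I_eq: "I = independence_graph L"
    and "sconnected I"
  shows
    "(is_cycle I \<or> is_path I) \<and>
     (\<forall>F \<in> nodes I. sdegree I F = 2 \<longrightarrow> card F = 2) \<and>
     (is_cycle I \<longrightarrow> is_cycle (complement L)) \<and>
     ((\<exists>n\<ge>2. is_path_of_length I n) \<or> is_cycle I \<longrightarrow> odd k) \<and>
     \<Union> {dangerous_set_of G s k F |F. maximal_independent L F} = verts G - {s} \<and>
     (is_path_of_length I 1 \<longrightarrow>
       (\<exists>K K'. two_cliques_sharing_vertex (complement L) K K' \<and>
          real (card K) = (real (deg G s) + 1) / 2 \<and>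
          real (card K') = (real (deg G s) + 1) / 2) \<and>
       isolated_plus_balanced_complete_bipartite L) \<and>
     (\<forall>Is A1 Am l. is_path_seq I Is \<and> length Is \<ge> 3 \<and>
       A1 = dangerous_set_of G s k (hd Is) \<and> Am = dangerous_set_of G s k (last Is) \<and>
       l = card (cut_between G {s} A1) \<longrightarrow>
         card (cut_between G {s} Am) = l \<and> real l \<le> (real k + 3) / 2 \<and>
         A1 \<inter> Am = {} \<and>
         (length Is \<ge> 4 \<longrightarrow> real (card (cut_between G A1 Am)) = (real k + 3) / 2 - real l) \<and>
         (length Is = 3 \<longrightarrow> real (card (cut_between G A1 Am)) = real k + 1 - real l)) \<and>
     (is_path I \<longrightarrow>
       (\<exists>K K' p. two_cliques_joined_by_path (complement L) K K' p \<and>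
          card K = card K' \<and> real (card K) \<le> (real k + 3) / 2))"
proof -
  interpret c: connected_lifting_setting G s k
    by unfold_locales (use assms in simp_all)
  show ?thesis
    unfolding I_eq L_eq
  proof (intro conjI allI impI ballI, goal_cases)
    case 1
    then show ?case by (rule c.cycle_or_path)
  next
    case (2 F)
    then show ?case using c.card_line_degree_two by (simp add: c.nodes_I)
  next
    case 3
    then show ?case by (rule c.cycle_facts(1))
  next
    case 4
    then show ?case using c.long_path_odd c.cycle_facts(2) by blast
  next
    case 5
    then show ?case by (rule c.Union_dangerous_sets)
  next
    case 6
    then show ?case by (rule c.path_length_one(1))
  next
    case 7
    then show ?case by (rule c.path_length_one(2))
  next
    case (8 Is A1 Am l)
    then show ?case using c.long_path_ends(1)[of Is A1 Am l] by blast
  next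
    case (9 Is A1 Am l)
    then show ?case using c.long_path_ends(2)[of Is A1 Am l] by blast
  next
    case (10 Is A1 Am l)
    then show ?case using c.long_path_ends(3)[of Is A1 Am l] by blast
  next
    case (11 Is A1 Am l)
    then show ?case using c.long_path_ends(4)[of Is A1 Am l] by blast
  next
    case (12 Is A1 Am l)
    then show ?case using c.long_path_ends(5)[of Is A1 Am l] by blast
  next
    case 13
    then show ?case by (rule c.path_complement)
  qed
qed

end
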